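(* Let $p>1$. There exist constants $b=b(p)\ge1$ and $c=c(p)>0$ such that for every $R>0$ and all $u\in C_c^\infty((0,R))$ $$\sup_{x,y\in(0,R),\; x\neq y}\left\{\frac{|u(x)-u(y)|}{|x-y|^{1-1/p}}X^{1/p}\Big(\frac{|x-y|}{D}\Big)\right\}\le c\left(\int_0^R|u'|^pdx-\Big(\frac{p-1}{p}\Big)^p\int_0^R\frac{|u|^p}{d^p}dx\right)^{1/p},$$ where $D=bR$. The weight function $X^{1/p}$ is optimal in the sense that the power $1/p$ cannot be decreased: for every $q<1/p$ there are no constants $b\ge1$, $c>0$ such that the inequality with $X^{1/p}$ replaced by $X^q$ holds for all $u\in C_c^\infty((0,R))$.
   Context: $d=d(x):=\min\{x,R-x\}$ for $x\in(0,R)$. $X(t):=(1-\log t)^{-1}$ for $t\in(0,1]$, and $X^{q}(t)=(X(t))^{q}$. *)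

theory Defs
  imports "HOL-Analysis.Analysis"
begin

definition bdist :: "real \<Rightarrow> real \<Rightarrow> real" where
  "bdist R x = min x (R - x)"

text \<open>Only used for arguments in \<open>(0,1]\<close>, where the value lies in \<open>(0,1]\<close>.\<close>

definition X :: "real \<Rightarrow> real" where
  "X t = inverse (1 - ln t)"

text \<open>The space of real-valued \<open>C_c^\<infinity>\<close> functions on \<open>(0,R)\<close>, whose elements are identified
  with their extensions by zero to the real line.\<close>

definition test_functions :: "real \<Rightarrow> (real \<Rightarrow> real) set" where
  "test_functions R = {u. (\<forall>n. (deriv ^^ n) u differentiable_on UNIV) \<and>
     compact (closure {x. u x \<noteq> 0}) \<and> closure {x. u x \<noteq> 0} \<subseteq> {0<..<R}}"

definition hardy_deficit :: "real \<Rightarrow> real \<Rightarrow> (real \<Rightarrow> real) \<Rightarrow> real" where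
  "hardy_deficit p R u =
     (LINT x:{0<..<R}|lborel. \<bar>deriv u x\<bar> powr p)
     - ((p - 1) / p) powr p * (LINT x:{0<..<R}|lborel. \<bar>u x\<bar> powr p / bdist R x powr p)"

text \<open>The supremum is taken in \<^typ>\<open>ereal\<close>, so that it is \<open>\<infinity>\<close> when the quotients are unbounded.
  The exponent \<open>q\<close> of the weight is an arbitrary real.\<close>

definition weighted_hoelder_seminorm ::
  "real \<Rightarrow> real \<Rightarrow> real \<Rightarrow> real \<Rightarrow> (real \<Rightarrow> real) \<Rightarrow> ereal" where
  "weighted_hoelder_seminorm p q D R u =
     (SUP (x, y) \<in> {(x, y). x \<in> {0<..<R} \<and> y \<in> {0<..<R} \<and> x \<noteq> y}.
        ereal (\<bar>u x - u y\<bar> / \<bar>x - y\<bar> powr (1 - 1 / p) * X (\<bar>x - y\<bar> / D) powr q))"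

text \<open>The base of the outer power on the right is nonnegative by the classical Hardy inequality,
  so \<open>powr\<close> has its usual meaning there.\<close>

definition hardy_morrey_ineq ::
  "real \<Rightarrow> real \<Rightarrow> real \<Rightarrow> real \<Rightarrow> real \<Rightarrow> (real \<Rightarrow> real) \<Rightarrow> bool" where
  "hardy_morrey_ineq p q b c R u \<longleftrightarrow>
     weighted_hoelder_seminorm p q (b * R) R u \<le> ereal (c * hardy_deficit p R u powr (1 / p))"

end

theory Submission
  imports Defs
begin

text \<open>
  Put \<open>H = (p - 1) / p\<close>. For a nonnegative weight \<open>w\<close>, Young's inequality bounds the derivative of
  \<open>w |u|^p\<close> by \<open>|u'|^p + (w' + (p - 1) w^(p/(p-1))) |u|^p\<close>; hence any solution of the Riccati
  inequality \<open>w' + (p - 1) w^(p/(p-1)) + H^p x^(-p) \<le> 0\<close> bounds the Hardy deficit on an interval from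
  below by boundary terms. The weight \<open>w\<^sub>0 = H^(p-1) x^(1-p)\<close> gives equality, and multiplying it by
  \<open>1 - 1 / (1 + p ln (L / x))\<close> is still admissible. Using \<open>w\<^sub>0\<close> on \<open>(0, x)\<close> and the reduced weight on
  \<open>(x, L)\<close>, the mismatch at \<open>x\<close> yields \<open>|u x|^p \<le> C x^(p-1) (1 + ln (L / x))\<close> times the deficit.
  If \<open>|x - y|\<close> is at least the distance of the pair to the boundary this is already the claim; otherwise
  the same bound controls the Hardy term, hence \<open>|u'|^p\<close>, on \<open>[x, y]\<close>, and Jensen's inequality applies.

  For optimality take \<open>u = x^H v\<close> with \<open>v\<close> a fixed bump in the variable \<open>- ln x / N\<close>: the deficit is
  \<open>O(1/N)\<close>, while the unweighted Hoelder quotient stays bounded below at scale \<open>exp (- 3 N / 2)\<close>,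
  where \<open>X\<close> is of order \<open>1/N\<close>.
\<close>

section \<open>Tangent-line inequalities for powers, and the comparison with a Riccati
  weight\<close>

section \<open>Lower bounds from Riccati inequalities\<close>

text \<open>Convexity in tangent form: A^p lies above its tangent at B, with equality for A = B. It
  is Young's inequality with exponents p and p/(p-1) applied to A and B^(p-1).\<close>

lemma young_powr:
  fixes p A B :: real
  assumes "p > 1" "A \<ge> 0" "B \<ge> 0"
  shows "p * B powr (p - 1) * A \<le> A powr p + (p - 1) * B powr p"
proof -
  have "A * B powr (p - 1) \<le> A powr p / p + (B powr (p - 1)) powr (p / (p - 1)) / (p / (p - 1))"
    using assms by (intro Youngs_inequality) (auto simp: field_simps)
  also have "(B powr (p - 1)) powr (p / (p - 1)) = B powr p"
    using assms by (simp add: powr_powr)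
  finally show ?thesis
    using assms by (simp add: field_simps)
qed

text \<open>Since p > 1, the formula also holds at the origin, where the difference quotient is
  bounded by |h|^(p-1). Hence |u|^p can be differentiated at the zeros of u as well.\<close>

lemma has_real_derivative_abs_powr:
  fixes p x :: real
  assumes "p > 1"
  shows "((\<lambda>x. \<bar>x\<bar> powr p) has_real_derivative p * \<bar>x\<bar> powr (p - 1) * sgn x) (at x)"
proof (cases "x = 0")
  case True
  have "((\<lambda>h. \<bar>h\<bar> powr p / h) \<longlongrightarrow> 0) (at 0)"
  proof (rule tendsto_0_le[where K = 1])
    show "((\<lambda>h::real. \<bar>h\<bar> powr (p - 1)) \<longlongrightarrow> 0) (at 0)"
      using assms by (intro tendsto_eq_intros tendsto_rabs_zero) auto
    show "\<forall>\<^sub>F h::real in at 0. norm (\<bar>h\<bar> powr p / h) \<le> norm (\<bar>h\<bar> powr (p - 1)) * 1"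
      by (intro always_eventually) (auto simp: powr_diff)
  qed
  then show ?thesis
    using True by (simp add: DERIV_def)
next
  case False
  have "\<forall>\<^sub>F y in nhds x. \<bar>y\<bar> powr p = (sgn x * y) powr p"
  proof -
    have "\<forall>\<^sub>F y in nhds x. sgn x * y > 0"
      using False by (intro order_tendstoD(1)[of _ "sgn x * x"] tendsto_intros)
        (auto simp: sgn_if filterlim_ident)
    then show ?thesis
      by eventually_elim (auto simp: sgn_if split: if_splits)
  qed
  moreover have "((\<lambda>y. (sgn x * y) powr p) has_real_derivative p * \<bar>x\<bar> powr (p - 1) * sgn x) (at x)"
    using False by (auto intro!: derivative_eq_intros simp: sgn_if powr_diff divide_simps)
  ultimately show ?thesis
    by (subst DERIV_cong_ev[OF refl _ refl]) auto
qed

text \<open>Instead of Hoelder's inequality, the tangent inequality for |u'|^p is integrated, with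
  the point of tangency at the absolute mean slope \<open>m\<close>; this choice loses
  nothing.\<close>

lemma jensen_increment:
  fixes u u' :: "real \<Rightarrow> real"
  assumes "p > 1" "x < y" and du: "\<And>s. s \<in> {x..y} \<Longrightarrow> (u has_real_derivative u' s) (at s)"
    and cont: "continuous_on {x..y} u'"
  shows "\<bar>u y - u x\<bar> powr p \<le> (y - x) powr (p - 1) * integral {x..y} (\<lambda>s. \<bar>u' s\<bar> powr p)"
proof -
  define m where "m = \<bar>u y - u x\<bar> / (y - x)"
  \<comment> \<open>The signed coefficient of the tangent at \<open>m\<close>: it makes
    \<open>k * (u y - u x)\<close> equal to p m^p (y - x).\<close>
  define k where "k = p * m powr (p - 1) * sgn (u y - u x)"
  have m: "m \<ge> 0" using assms by (auto simp: m_def)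
  have "((\<lambda>s. k * u' s) has_integral k * (u y - u x)) {x..y}"
    using assms by (intro has_integral_mult_right fundamental_theorem_of_calculus)
      (auto simp: has_real_derivative_iff_has_vector_derivative has_vector_derivative_at_within)
  moreover have "((\<lambda>s. \<bar>u' s\<bar> powr p) has_integral integral {x..y} (\<lambda>s. \<bar>u' s\<bar> powr p)) {x..y}"
    using assms by (intro integrable_integral integrable_continuous_interval continuous_intros
      continuous_on_powr') auto
  then have "((\<lambda>s. \<bar>u' s\<bar> powr p + (p - 1) * m powr p) has_integral
      integral {x..y} (\<lambda>s. \<bar>u' s\<bar> powr p) + (y - x) * ((p - 1) * m powr p)) {x..y}"
    using has_integral_const_real[of "(p - 1) * m powr p" x y] \<open>x < y\<close>
    by (intro has_integral_add) auto
  ultimately have "k * (u y - u x) \<le>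
      integral {x..y} (\<lambda>s. \<bar>u' s\<bar> powr p) + (y - x) * ((p - 1) * m powr p)"
  proof (rule has_integral_le)
    fix s
    have "k * u' s \<le> p * m powr (p - 1) * \<bar>u' s\<bar>"
      using \<open>p > 1\<close> by (auto simp: k_def sgn_if abs_if mult_nonneg_nonpos)
    also have "\<dots> \<le> \<bar>u' s\<bar> powr p + (p - 1) * m powr p"
      using young_powr[of p "\<bar>u' s\<bar>" m] assms m by simp
    finally show "k * u' s \<le> \<bar>u' s\<bar> powr p + (p - 1) * m powr p" .
  qed
  moreover have "k * (u y - u x) = p * ((y - x) * m powr p)"
  proof (cases "m = 0")
    case False
    have "k * (u y - u x) = p * m powr (p - 1) * \<bar>u y - u x\<bar>"
      by (simp add: k_def sgn_if)
    also have "\<bar>u y - u x\<bar> = m * (y - x)"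
      using \<open>x < y\<close> by (simp add: m_def)
    finally show ?thesis
      using False m by (simp add: powr_diff)
  qed (use assms in \<open>auto simp: k_def\<close>)
  ultimately have "(y - x) * m powr p \<le> integral {x..y} (\<lambda>s. \<bar>u' s\<bar> powr p)"
    by (simp add: algebra_simps)
  moreover have "\<bar>u y - u x\<bar> powr p = (y - x) powr (p - 1) * ((y - x) * m powr p)"
    using \<open>x < y\<close> by (simp add: m_def powr_divide powr_diff)
  ultimately show ?thesis
    by (simp add: mult_left_mono)
qed

text \<open>The left side is the integral of the derivative of w |u|^p, which Young's inequality and
  the Riccati inequality bound pointwise by the integrand on the right. Both boundary terms are
  kept, so that intervals with different weights can be glued at a point where u does not
  vanish.\<close>

lemma riccati_lower_bound:
  fixes u u' w w' V :: "real \<Rightarrow> real"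
  assumes p: "p > 1" and ab: "a \<le> b"
    and du: "\<And>x. x \<in> {a..b} \<Longrightarrow> (u has_real_derivative u' x) (at x)"
    and dw: "\<And>x. x \<in> {a..b} \<Longrightarrow> (w has_real_derivative w' x) (at x)"
    and w: "\<And>x. x \<in> {a..b} \<Longrightarrow> w x \<ge> 0"
    and cont: "continuous_on {a..b} u'" "continuous_on {a..b} V"
    and riccati: "\<And>x. x \<in> {a..b} \<Longrightarrow> w' x + (p - 1) * w x powr (p / (p - 1)) + V x \<le> 0"
  shows "w b * \<bar>u b\<bar> powr p - w a * \<bar>u a\<bar> powr p
      \<le> integral {a..b} (\<lambda>x. \<bar>u' x\<bar> powr p - V x * \<bar>u x\<bar> powr p)"
proof -
  have "((\<lambda>x. w' x * \<bar>u x\<bar> powr p + (p * \<bar>u x\<bar> powr (p - 1) * sgn (u x) * u' x) * w x)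
      has_integral w b * \<bar>u b\<bar> powr p - w a * \<bar>u a\<bar> powr p) {a..b}"
  proof (rule fundamental_theorem_of_calculus[OF ab])
    fix x assume x: "x \<in> {a..b}"
    have "((\<lambda>x. \<bar>u x\<bar> powr p) has_real_derivative p * \<bar>u x\<bar> powr (p - 1) * sgn (u x) * u' x) (at x)"
      using DERIV_chain2[OF has_real_derivative_abs_powr[OF p] du[OF x]] .
    from DERIV_mult[OF dw[OF x] this]
    show "((\<lambda>x. w x * \<bar>u x\<bar> powr p) has_vector_derivative
        w' x * \<bar>u x\<bar> powr p + (p * \<bar>u x\<bar> powr (p - 1) * sgn (u x) * u' x) * w x) (at x within {a..b})"
      by (simp add: has_real_derivative_iff_has_vector_derivative has_vector_derivative_at_within)
  qed
  moreover have "continuous_on {a..b} u"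
    using du DERIV_isCont by (blast intro: continuous_at_imp_continuous_on)
  then have "((\<lambda>x. \<bar>u' x\<bar> powr p - V x * \<bar>u x\<bar> powr p) has_integral
      integral {a..b} (\<lambda>x. \<bar>u' x\<bar> powr p - V x * \<bar>u x\<bar> powr p)) {a..b}"
    using p cont by (intro integrable_integral integrable_continuous_interval continuous_intros
      continuous_on_powr') auto
  ultimately show ?thesis
  proof (rule has_integral_le)
    fix x assume x: "x \<in> {a..b}"
    \<comment> \<open>Chosen so that B^(p-1) is w |u|^(p-1), the factor in front of u' in the
      derivative of w |u|^p.\<close>
    define B where "B = w x powr (1 / (p - 1)) * \<bar>u x\<bar>"
    have B: "B powr p = w x powr (p / (p - 1)) * \<bar>u x\<bar> powr p" "B powr (p - 1) = w x * \<bar>u x\<bar> powr (p - 1)"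
      using w[OF x] p by (auto simp: B_def powr_mult powr_powr)
    have "(p * \<bar>u x\<bar> powr (p - 1) * sgn (u x) * u' x) * w x \<le> p * B powr (p - 1) * \<bar>u' x\<bar>"
    proof -
      have "sgn (u x) * u' x \<le> \<bar>u' x\<bar>" by (auto simp: sgn_if)
      then have "(p * \<bar>u x\<bar> powr (p - 1) * w x) * (sgn (u x) * u' x) \<le> (p * \<bar>u x\<bar> powr (p - 1) * w x) * \<bar>u' x\<bar>"
        using p w[OF x] by (intro mult_left_mono) auto
      then show ?thesis by (simp add: B mult_ac)
    qed
    also have "\<dots> \<le> \<bar>u' x\<bar> powr p + (p - 1) * B powr p"
      using p w[OF x] by (intro young_powr) (auto simp: B_def)
    finally have 1: "(p * \<bar>u x\<bar> powr (p - 1) * sgn (u x) * u' x) * w x \<le> \<bar>u' x\<bar> powr p + (p - 1) * B powr p" .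
    have "(w' x + (p - 1) * w x powr (p / (p - 1)) + V x) * \<bar>u x\<bar> powr p \<le> 0"
      using riccati[OF x] by (simp add: mult_nonpos_nonneg)
    with 1 show "w' x * \<bar>u x\<bar> powr p + (p * \<bar>u x\<bar> powr (p - 1) * sgn (u x) * u' x) * w x
        \<le> \<bar>u' x\<bar> powr p - V x * \<bar>u x\<bar> powr p"
      by (simp add: B algebra_simps)
  qed
qed

text \<open>With V = H^p x^(-p) this weight solves the Riccati equation exactly: in units of V the
  three terms are -p, p - 1 and 1.\<close>

lemma hardy_weight:
  fixes p x :: real
  assumes "p > 1" "x > 0"
  shows "((\<lambda>x. ((p - 1) / p) powr (p - 1) * x powr (1 - p)) has_real_derivative
      - (p * ((p - 1) / p) powr p * x powr - p)) (at x)"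
    and "(((p - 1) / p) powr (p - 1) * x powr (1 - p)) powr (p / (p - 1)) = ((p - 1) / p) powr p * x powr - p"
proof -
  have "p * ((p - 1) / p) powr p = (p - 1) * ((p - 1) / p) powr (p - 1)"
    using assms by (simp add: powr_diff)
  then have "- (p * ((p - 1) / p) powr p * x powr - p) = ((p - 1) / p) powr (p - 1) * ((1 - p) * x powr - p)"
    by (simp only: minus_mult_left) (simp add: algebra_simps)
  then show "((\<lambda>x. ((p - 1) / p) powr (p - 1) * x powr (1 - p)) has_real_derivative
      - (p * ((p - 1) / p) powr p * x powr - p)) (at x)"
    using assms by (auto intro!: derivative_eq_intros)
  have "(1 - p) * (p / (p - 1)) = - p"
    using assms by (simp add: field_simps)
  then show "(((p - 1) / p) powr (p - 1) * x powr (1 - p)) powr (p / (p - 1)) = ((p - 1) / p) powr p * x powr - p"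
    using assms by (simp add: powr_mult powr_powr)
qed

text \<open>With z = r \<eta>, the chain is (1 - \<eta>)^r \<le> exp(-z) \<le> 1/(1 + z) \<le> 1 - z
  + z^2. It needs no smallness of z, which matters because r = p/(p-1) is large for p near
  1.\<close>

lemma powr_one_minus_le:
  fixes r \<eta> :: real
  assumes "r > 0" "0 \<le> \<eta>" "\<eta> \<le> 1"
  shows "(1 - \<eta>) powr r \<le> 1 - r * \<eta> + (r * \<eta>)\<^sup>2"
proof -
  have z: "r * \<eta> \<ge> 0" using assms by simp
  have "(1 - \<eta>) powr r \<le> exp (- \<eta>) powr r"
    using assms exp_ge_add_one_self[of "- \<eta>"] by (intro powr_mono2) auto
  also have "\<dots> = inverse (exp (r * \<eta>))"
    by (simp add: powr_def mult.commute flip: exp_minus)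
  also have "\<dots> \<le> inverse (1 + r * \<eta>)"
    using z by (intro le_imp_inverse_le exp_ge_add_one_self) auto
  also have "\<dots> \<le> 1 - r * \<eta> + (r * \<eta>)\<^sup>2"
  proof -
    \<comment> \<open>The right side is 1 + z^3 with z = r \<eta>.\<close>
    have "1 \<le> (1 - r * \<eta> + (r * \<eta>)\<^sup>2) * (1 + r * \<eta>)"
      using zero_le_power[OF z, of 3] by (simp add: algebra_simps power2_eq_square power3_eq_cube)
    then show ?thesis using z by (simp add: field_simps)
  qed
  finally show ?thesis .
qed

section \<open>Pointwise and Hoelder bounds near one end point, where the distance to the boundary
  is the variable itself\<close>

section \<open>The half interval\<close>

text \<open>This is the integrand of the Hardy deficit where d(s) = s. The derivative is a separate
  argument, so that the reflected function u(R - s) can be inserted together with its explicit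
  derivative.\<close>

definition hardy_density :: "real \<Rightarrow> (real \<Rightarrow> real) \<Rightarrow> (real \<Rightarrow> real) \<Rightarrow> real \<Rightarrow> real" where
  "hardy_density p u u' s = \<bar>u' s\<bar> powr p - (((p - 1) / p) powr p * s powr - p) * \<bar>u s\<bar> powr p"

text \<open>The factor p in \<eta> gives x \<eta>' = p \<eta>^2. In units of H^p x^(-p),
  differentiating 1 - \<eta> then contributes -p^2/(p-1) \<eta>^2, which cancels exactly the
  quadratic remainder of (1 - \<eta>)^(p/(p-1)); the constant and linear terms cancel too. Since
  \<eta>(L) = 1, the weight vanishes at L.\<close>

lemma hardy_log_weight:
  fixes p L x :: real
  defines "\<eta> \<equiv> \<lambda>x. 1 / (1 + p * ln (L / x))"
  defines "w \<equiv> \<lambda>x. ((p - 1) / p) powr (p - 1) * x powr (1 - p) * (1 - \<eta> x)"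
  defines "w' \<equiv> \<lambda>x. ((p - 1) / p) powr p * x powr - p * (- (p * (1 - \<eta> x)) - p\<^sup>2 / (p - 1) * (\<eta> x)\<^sup>2)"
  assumes "p > 1" "0 < x" "x \<le> L"
  shows "0 \<le> w x"
    and "(w has_real_derivative w' x) (at x)"
    and "w' x + (p - 1) * w x powr (p / (p - 1)) + ((p - 1) / p) powr p * x powr - p \<le> 0"
proof -
  have ln: "ln (L / x) \<ge> 0"
    using assms by simp
  then have pos: "1 + p * ln (L / x) > 0"
    using assms by (simp add: add_pos_nonneg)
  have \<eta>: "0 \<le> \<eta> x" "\<eta> x \<le> 1"
    using ln pos assms by (auto simp: \<eta>_def field_simps)
  show "0 \<le> w x"
    using \<eta> by (simp add: w_def)
  have d\<eta>: "(\<eta> has_real_derivative p * (\<eta> x)\<^sup>2 / x) (at x)"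
    unfolding \<eta>_def using assms(4-6) pos
    by (auto intro!: derivative_eq_intros simp: divide_simps power2_eq_square)
  have Hp: "((p - 1) / p) powr (p - 1) = ((p - 1) / p) powr p * (p / (p - 1))"
    using assms by (simp add: powr_diff)
  have "(w has_real_derivative
      - (p * ((p - 1) / p) powr p * x powr - p) * (1 - \<eta> x) +
      (0 - p * (\<eta> x)\<^sup>2 / x) * (((p - 1) / p) powr (p - 1) * x powr (1 - p))) (at x)"
    unfolding w_def
    by (intro DERIV_mult DERIV_diff DERIV_const d\<eta> hardy_weight(1)) (use assms in auto)
  moreover have "x powr (1 - p) = x * x powr - p"
    using assms by (simp add: powr_diff powr_minus divide_simps)
  then have "- (p * ((p - 1) / p) powr p * x powr - p) * (1 - \<eta> x) +
      (0 - p * (\<eta> x)\<^sup>2 / x) * (((p - 1) / p) powr (p - 1) * x powr (1 - p)) = w' x"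
    using \<open>x > 0\<close> unfolding w'_def Hp by (simp add: algebra_simps power2_eq_square)
  ultimately show "(w has_real_derivative w' x) (at x)"
    by simp
  have "(1 - \<eta> x) powr (p / (p - 1)) \<le> 1 - p / (p - 1) * \<eta> x + (p / (p - 1) * \<eta> x)\<^sup>2"
    using assms \<eta> by (intro powr_one_minus_le) auto
  then have "(p - 1) * (1 - \<eta> x) powr (p / (p - 1)) \<le>
      (p - 1) * (1 - p / (p - 1) * \<eta> x + (p / (p - 1) * \<eta> x)\<^sup>2)"
    using assms by (intro mult_left_mono) auto
  also have "\<dots> = (p - 1) - p * \<eta> x + p\<^sup>2 / (p - 1) * (\<eta> x)\<^sup>2"
    using assms(4) by (simp add: divide_simps power2_eq_square)
  finally have "- (p * (1 - \<eta> x)) - p\<^sup>2 / (p - 1) * (\<eta> x)\<^sup>2 + (p - 1) * (1 - \<eta> x) powr (p / (p - 1)) + 1 \<le> 0"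
    by (simp add: algebra_simps)
  then have "((p - 1) / p) powr p * x powr - p * (- (p * (1 - \<eta> x)) - p\<^sup>2 / (p - 1) * (\<eta> x)\<^sup>2
      + (p - 1) * (1 - \<eta> x) powr (p / (p - 1)) + 1) \<le> 0"
    by (intro mult_nonneg_nonpos) auto
  moreover have "w x powr (p / (p - 1)) = ((p - 1) / p) powr p * x powr - p * (1 - \<eta> x) powr (p / (p - 1))"
    using hardy_weight(2)[of p x] assms(4-6) \<eta> by (simp add: w_def powr_mult)
  ultimately show "w' x + (p - 1) * w x powr (p / (p - 1)) + ((p - 1) / p) powr p * x powr - p \<le> 0"
    unfolding w'_def by (simp add: algebra_simps)
qed

lemma hardy_density_integrable:
  assumes "p > 1" "0 < a"
    and du: "\<And>s. s \<in> {a..b} \<Longrightarrow> (u has_real_derivative u' s) (at s)"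
    and cont: "continuous_on {a..b} u'"
  shows "hardy_density p u u' integrable_on {a..b}"
proof -
  have "continuous_on {a..b} u"
    using du DERIV_isCont by (blast intro: continuous_at_imp_continuous_on)
  then show ?thesis
    unfolding hardy_density_def[abs_def] using assms
    by (intro integrable_continuous_interval continuous_intros continuous_on_powr') auto
qed

lemma hardy_density_lower_bound:
  assumes "p > 1" "0 < a" "a \<le> b"
    and "\<And>s. s \<in> {a..b} \<Longrightarrow> (u has_real_derivative u' s) (at s)"
    and "continuous_on {a..b} u'"
  shows "((p - 1) / p) powr (p - 1) * b powr (1 - p) * \<bar>u b\<bar> powr p
      - ((p - 1) / p) powr (p - 1) * a powr (1 - p) * \<bar>u a\<bar> powr p
      \<le> integral {a..b} (hardy_density p u u')"
  unfolding hardy_density_def[abs_def]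
  using assms hardy_weight
  by (intro riccati_lower_bound[where w' = "\<lambda>x. - (p * ((p - 1) / p) powr p * x powr - p)"])
    (auto intro!: continuous_intros simp: algebra_simps)

lemma hardy_density_integral_nonneg:
  assumes "p > 1" "0 < a" "a \<le> b"
    and "\<And>s. s \<in> {a..b} \<Longrightarrow> (u has_real_derivative u' s) (at s)"
    and "continuous_on {a..b} u'" "u a = 0"
  shows "0 \<le> integral {a..b} (hardy_density p u u')"
proof -
  have "0 \<le> ((p - 1) / p) powr (p - 1) * b powr (1 - p) * \<bar>u b\<bar> powr p
      - ((p - 1) / p) powr (p - 1) * a powr (1 - p) * \<bar>u a\<bar> powr p"
    using assms by simp
  also have "\<dots> \<le> integral {a..b} (hardy_density p u u')"
    using assms by (intro hardy_density_lower_bound) auto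
  finally show ?thesis .
qed

text \<open>The outer boundary terms vanish because \<open>u a = 0\<close> and the reduced weight is
  zero at L, so u is not constrained at L. What remains is the jump of the weight at x, namely the
  unreduced weight divided by 1 + p ln(L/x).\<close>

lemma hardy_pointwise_bound:
  fixes p a x L :: real and u u' :: "real \<Rightarrow> real"
  assumes p: "p > 1" and ax: "0 < a" "a \<le> x" "x \<le> L"
    and du: "\<And>s. s \<in> {a..L} \<Longrightarrow> (u has_real_derivative u' s) (at s)"
    and cont: "continuous_on {a..L} u'" and ua: "u a = 0"
  shows "((p - 1) / p) powr (p - 1) * x powr (1 - p) * \<bar>u x\<bar> powr p
    \<le> (1 + p * ln (L / x)) * integral {a..L} (hardy_density p u u')"
proof -
  define w where "w = (\<lambda>x. ((p - 1) / p) powr (p - 1) * x powr (1 - p) * (1 - 1 / (1 + p * ln (L / x))))"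
  let ?w0 = "((p - 1) / p) powr (p - 1) * x powr (1 - p)"
  have ln: "ln (L / x) \<ge> 0"
    using ax by simp
  then have pos: "1 + p * ln (L / x) > 0"
    using p by (simp add: add_pos_nonneg)
  have "?w0 * \<bar>u x\<bar> powr p \<le> integral {a..x} (hardy_density p u u')"
    using hardy_density_lower_bound[of p a x u u'] assms continuous_on_subset[OF cont, of "{a..x}"]
    by auto
  moreover have "w L * \<bar>u L\<bar> powr p - w x * \<bar>u x\<bar> powr p \<le> integral {x..L} (hardy_density p u u')"
    unfolding hardy_density_def[abs_def] w_def
    by (rule riccati_lower_bound[OF p \<open>x \<le> L\<close> _ hardy_log_weight(2)[OF p] hardy_log_weight(1)[OF p] _ _
          hardy_log_weight(3)[OF p]])
      (use ax du cont in \<open>auto intro!: continuous_intros intro: continuous_on_subset\<close>)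
  moreover have "w L = 0"
    using ax by (simp add: w_def)
  moreover have "integral {a..x} (hardy_density p u u') + integral {x..L} (hardy_density p u u')
      = integral {a..L} (hardy_density p u u')"
    using ax p du cont by (intro Henstock_Kurzweil_Integration.integral_combine hardy_density_integrable) auto
  ultimately have "?w0 * \<bar>u x\<bar> powr p - w x * \<bar>u x\<bar> powr p \<le> integral {a..L} (hardy_density p u u')"
    by simp
  also have "?w0 * \<bar>u x\<bar> powr p - w x * \<bar>u x\<bar> powr p = ?w0 * \<bar>u x\<bar> powr p / (1 + p * ln (L / x))"
    by (simp add: w_def algebra_simps)
  finally show ?thesis
    using pos by (simp add: field_simps)
qed

text \<open>With z = ln(t/s), the power (t/s)^(p-1) = exp((p-1) z) is at least 1 + (p-1) z, which
  outweighs the gain z of the logarithm once (p-1)(1 + ln(D/t)) is at least 1. The hypothesis on D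
  secures this and is the source of the constant exp(1/(p-1)).\<close>

lemma powr_log_weight_mono:
  fixes p s t D :: real
  assumes p: "p > 1" and st: "0 < s" "s \<le> t" and D: "t * exp (1 / (p - 1)) \<le> D"
  shows "s powr (p - 1) * (1 + ln (D / s)) \<le> t powr (p - 1) * (1 + ln (D / t))"
proof -
  define z where "z = ln (t / s)"
  have z: "z \<ge> 0" using st by (auto simp: z_def)
  have "0 < t * exp (1 / (p - 1))" using st by simp
  then have D0: "D > 0" using D by linarith
  have "exp (1 / (p - 1)) \<le> D / t"
    using st D by (simp add: field_simps)
  then have "ln (exp (1 / (p - 1))) \<le> ln (D / t)"
    by (intro ln_mono) (auto intro: less_le_trans[OF exp_gt_zero])
  then have ln_ge: "1 / (p - 1) \<le> ln (D / t)" by simp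
  moreover have "0 \<le> 1 / (p - 1)" using p by simp
  ultimately have nonneg: "0 \<le> 1 + ln (D / t)" by linarith
  have "1 \<le> (p - 1) * (1 + ln (D / t))"
    using p ln_ge by (simp add: field_simps)
  then have "1 + ln (D / t) + z \<le> 1 + ln (D / t) + ((p - 1) * (1 + ln (D / t))) * z"
    using z mult_right_mono[of 1 "(p - 1) * (1 + ln (D / t))" z] by simp
  also have "\<dots> = (1 + (p - 1) * z) * (1 + ln (D / t))"
    by (simp add: algebra_simps)
  also have "\<dots> \<le> (t / s) powr (p - 1) * (1 + ln (D / t))"
    using nonneg exp_ge_add_one_self[of "(p - 1) * z"] st
    by (intro mult_right_mono) (auto simp: z_def powr_def)
  also have "1 + ln (D / t) + z = 1 + ln (D / s)"
    using st D0 by (simp add: z_def ln_div)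
  finally show ?thesis
    using st by (simp add: powr_divide field_simps)
qed

text \<open>The constant adds the contributions of two cases. If x \<le> h = y - x, the pointwise
  bound at x and y gives 4^p A. If x > h, the integral of |u'|^p over [x, y] costs 1 for the
  deficit, A for the boundary term at y and A for the Hardy term.\<close>

lemma half_interval_hoelder:
  fixes p a x y L D :: real and u u' :: "real \<Rightarrow> real"
  defines "A \<equiv> p * ((p - 1) / p) powr (1 - p)"
  assumes p: "p > 1" and axy: "0 < a" "a \<le> x" "x < y" "y \<le> L" and D: "L * exp (1 / (p - 1)) \<le> D"
    and du: "\<And>s. s \<in> {a..L} \<Longrightarrow> (u has_real_derivative u' s) (at s)"
    and cont: "continuous_on {a..L} u'" and ua: "u a = 0"
  shows "\<bar>u x - u y\<bar> powr p \<le> (4 powr p * A + 2 * A + 1) *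
    ((y - x) powr (p - 1) * (1 + ln (D / (y - x))) * integral {a..L} (hardy_density p u u'))"
proof -
  define J where "J = integral {a..L} (hardy_density p u u')"
  define h where "h = y - x"
  define \<Lambda> where "\<Lambda> = (\<lambda>s. 1 + ln (D / s))"
  have h: "0 < h" "h < y" "h < L" using axy by (auto simp: h_def)
  have H: "((p - 1) / p) powr (p - 1) > 0" "((p - 1) / p) powr p \<le> 1"
    using p by (auto intro!: powr_le1 simp: divide_simps)
  have "L * 1 \<le> L * exp (1 / (p - 1))"
    using p axy by (intro mult_left_mono) auto
  then have LD: "L \<le> D" using D by simp
  have \<Lambda>_anti: "\<Lambda> t \<le> \<Lambda> s" if "0 < s" "s \<le> t" for s t
    using that LD axy by (auto simp: \<Lambda>_def intro!: divide_left_mono ln_mono)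
  have \<Lambda>_ge: "1 \<le> \<Lambda> s" if "0 < s" "s \<le> L" for s
    using that LD by (auto simp: \<Lambda>_def)
  have A: "A > 0" using p by (simp add: A_def)
  have bound: "\<bar>u s\<bar> powr p \<le> A * s powr (p - 1) * \<Lambda> s * J" and J_nonneg: "0 \<le> J"
    if s: "a \<le> s" "s \<le> L" for s
  proof -
    have le: "((p - 1) / p) powr (p - 1) * s powr (1 - p) * \<bar>u s\<bar> powr p \<le> (1 + p * ln (L / s)) * J"
      unfolding J_def using assms s by (intro hardy_pointwise_bound) auto
    have "ln (L / s) \<ge> 0"
      using s axy by simp
    then have pos: "1 + p * ln (L / s) > 0"
      using p by (simp add: add_pos_nonneg)
    have "0 \<le> (1 + p * ln (L / s)) * J"
      by (rule order_trans[OF _ le]) auto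
    then show "0 \<le> J" using pos by (simp add: zero_le_mult_iff)
    have "ln (L / s) \<le> ln (D / s)"
      using s axy LD by (intro ln_mono divide_right_mono) auto
    then have "1 + p * ln (L / s) \<le> p * \<Lambda> s"
      using p by (auto simp: \<Lambda>_def distrib_left intro!: add_mono mult_left_mono)
    then have "(1 + p * ln (L / s)) * J \<le> p * \<Lambda> s * J"
      using \<open>0 \<le> J\<close> by (intro mult_right_mono)
    with le have le': "((p - 1) / p) powr (p - 1) * s powr (1 - p) * \<bar>u s\<bar> powr p \<le> p * \<Lambda> s * J"
      by simp
    have inv: "c powr (1 - p) * c powr (p - 1) = 1" if "c > 0" for c :: real
      using that by (simp flip: powr_add)
    have "\<bar>u s\<bar> powr p = (((p - 1) / p) powr (1 - p) * ((p - 1) / p) powr (p - 1)) *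
        (s powr (1 - p) * s powr (p - 1)) * \<bar>u s\<bar> powr p"
      using p s axy by (simp add: inv)
    also have "\<dots> = ((p - 1) / p) powr (1 - p) * s powr (p - 1) *
        (((p - 1) / p) powr (p - 1) * s powr (1 - p) * \<bar>u s\<bar> powr p)"
      by (simp only: mult_ac)
    also have "\<dots> \<le> ((p - 1) / p) powr (1 - p) * s powr (p - 1) * (p * \<Lambda> s * J)"
      using le' by (intro mult_left_mono) auto
    finally show "\<bar>u s\<bar> powr p \<le> A * s powr (p - 1) * \<Lambda> s * J"
      by (simp add: A_def mult_ac)
  qed
  have J: "J \<ge> 0" using J_nonneg[of L] axy by auto
  have Kh: "1 \<le> \<Lambda> h" using \<Lambda>_ge[of h] h by auto
  show ?thesis
  proof (cases "x \<le> h")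
    case True
    \<comment> \<open>Both points lie in (0, 2h]. Below h the log weight is monotone; between h and
      2h the logarithmic factor decreases and the power grows by at most 2^(p-1).\<close>
    have near: "\<bar>u s\<bar> powr p \<le> 2 powr p * A * (h powr (p - 1) * \<Lambda> h * J)" if s: "s = x \<or> s = y" for s
    proof -
      have s': "a \<le> s" "0 < s" "s \<le> L" "s \<le> 2 * h" using s axy True by (auto simp: h_def)
      have "s powr (p - 1) * \<Lambda> s \<le> 2 powr p * h powr (p - 1) * \<Lambda> h"
      proof (cases "s \<le> h")
        case True
        have "h * exp (1 / (p - 1)) \<le> D"
          by (rule order_trans[OF mult_right_mono D]) (use h in auto)
        then have "s powr (p - 1) * \<Lambda> s \<le> h powr (p - 1) * \<Lambda> h"
          unfolding \<Lambda>_def using p s' True by (intro powr_log_weight_mono)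
        also have "\<dots> \<le> 2 powr p * (h powr (p - 1) * \<Lambda> h)"
          using mult_right_mono[of 1 "2 powr p" "h powr (p - 1) * \<Lambda> h"] p Kh by (simp add: ge_one_powr_ge_zero)
        finally show ?thesis by simp
      next
        case False
        have "s powr (p - 1) \<le> (2 * h) powr (p - 1)"
          using s' p by (intro powr_mono2) auto
        also have "\<dots> = 2 powr (p - 1) * h powr (p - 1)"
          using h by (simp add: powr_mult)
        also have "\<dots> \<le> 2 powr p * h powr (p - 1)"
          by (intro mult_right_mono powr_mono) auto
        finally show ?thesis
          using False s' h \<Lambda>_anti[of h s] \<Lambda>_ge[of s] by (intro mult_mono) auto
      qed
      then have "A * J * (s powr (p - 1) * \<Lambda> s) \<le> A * J * (2 powr p * h powr (p - 1) * \<Lambda> h)"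
        using A J by (intro mult_left_mono) auto
      with bound[of s] s' show ?thesis by (simp add: mult_ac)
    qed
    define M where "M = max \<bar>u x\<bar> \<bar>u y\<bar>"
    have "\<bar>u x - u y\<bar> powr p \<le> (2 * M) powr p"
      using p by (intro powr_mono2) (auto simp: M_def)
    also have "\<dots> = 2 powr p * M powr p"
      by (simp add: powr_mult M_def)
    also have "\<dots> \<le> 2 powr p * (2 powr p * A * (h powr (p - 1) * \<Lambda> h * J))"
      using near by (intro mult_left_mono) (auto simp: M_def max_def)
    also have "\<dots> = (4 powr p * A) * (h powr (p - 1) * \<Lambda> h * J)"
      using powr_mult[of 2 2 p] by simp
    also have "\<dots> \<le> (4 powr p * A + 2 * A + 1) * (h powr (p - 1) * \<Lambda> h * J)"
      using A J Kh by (intro mult_right_mono) auto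
    finally show ?thesis
      by (simp add: h_def \<Lambda>_def J_def)
  next
    case False
    let ?P = "\<lambda>s. \<bar>u' s\<bar> powr p"
    have contu: "continuous_on {a..L} u"
      using du DERIV_isCont by (blast intro: continuous_at_imp_continuous_on)
    have split1: "integral {a..x} (hardy_density p u u') + integral {x..L} (hardy_density p u u') = J"
      unfolding J_def using axy p du cont
      by (intro Henstock_Kurzweil_Integration.integral_combine hardy_density_integrable) auto
    have split2: "integral {x..y} (hardy_density p u u') + integral {y..L} (hardy_density p u u')
        = integral {x..L} (hardy_density p u u')"
      using axy p du cont
      by (intro Henstock_Kurzweil_Integration.integral_combine hardy_density_integrable)
        (auto intro: continuous_on_subset)
    have "((p - 1) / p) powr (p - 1) * x powr (1 - p) * \<bar>u x\<bar> powr p \<le> integral {a..x} (hardy_density p u u')"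
      using hardy_density_lower_bound[of p a x u u'] assms continuous_on_subset[OF cont, of "{a..x}"]
      by auto
    then have left: "0 \<le> integral {a..x} (hardy_density p u u')"
      by (rule order_trans[rotated]) auto
    \<comment> \<open>The density need not have a nonnegative integral over [y, L], since u may be
      nonzero at y. Its negative part is at most the boundary term at y, which \<open>ub\<close>
      controls.\<close>
    have "((p - 1) / p) powr (p - 1) * L powr (1 - p) * \<bar>u L\<bar> powr p
        - ((p - 1) / p) powr (p - 1) * y powr (1 - p) * \<bar>u y\<bar> powr p \<le> integral {y..L} (hardy_density p u u')"
      using hardy_density_lower_bound[of p y L u u'] assms continuous_on_subset[OF cont, of "{y..L}"]
      by auto
    then have right: "- (((p - 1) / p) powr (p - 1) * y powr (1 - p) * \<bar>u y\<bar> powr p)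
        \<le> integral {y..L} (hardy_density p u u')"
      by (rule order_trans[rotated]) auto
    have Hle: "((p - 1) / p) powr (p - 1) \<le> 1"
      using p by (auto intro!: powr_le1 simp: divide_simps)
    have ub: "((p - 1) / p) powr (p - 1) * y powr (1 - p) * \<bar>u y\<bar> powr p \<le> A * \<Lambda> h * J"
    proof -
      have "((p - 1) / p) powr (p - 1) * y powr (1 - p) * \<bar>u y\<bar> powr p
          \<le> 1 * y powr (1 - p) * (A * y powr (p - 1) * \<Lambda> y * J)"
        using Hle bound[of y] axy by (intro mult_mono) auto
      also have "\<dots> = A * \<Lambda> y * J"
        using axy by (simp add: powr_diff)
      also have "\<dots> \<le> A * \<Lambda> h * J"
        using A J \<Lambda>_anti[of h y] h by (intro mult_right_mono mult_left_mono) auto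
      finally show ?thesis .
    qed
    have intP: "?P integrable_on {x..y}"
      using p cont axy by (intro integrable_continuous_interval continuous_intros continuous_on_powr')
        (auto intro: continuous_on_subset)
    \<comment> \<open>|u'|^p is the density plus the Hardy term, and the pointwise bound makes the
      latter at most A \<Lambda>(h) J / x on [x, y]. As the interval has length h < x, this
      integrates to at most A \<Lambda>(h) J.\<close>
    have "integral {x..y} ?P \<le> integral {x..y} (\<lambda>s. hardy_density p u u' s + A * \<Lambda> h * J / x)"
    proof (rule integral_le)
      show "(\<lambda>s. hardy_density p u u' s + A * \<Lambda> h * J / x) integrable_on {x..y}"
        using axy p du cont by (intro integrable_add hardy_density_integrable integrable_const_ivl)
          (auto intro: continuous_on_subset)
      fix s assume s: "s \<in> {x..y}"
      have "((p - 1) / p) powr p * s powr - p * \<bar>u s\<bar> powr p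
          \<le> 1 * s powr - p * (A * s powr (p - 1) * \<Lambda> s * J)"
        using H bound[of s] s axy by (intro mult_mono) auto
      also have "\<dots> = A * \<Lambda> s * J * (1 / s)"
        using s axy by (simp add: powr_diff powr_minus field_simps)
      also have "\<dots> \<le> A * \<Lambda> h * J * (1 / x)"
        using A J Kh \<Lambda>_anti[of h s] h s axy False by (intro mult_mono divide_left_mono mult_left_mono) auto
      finally show "?P s \<le> hardy_density p u u' s + A * \<Lambda> h * J / x"
        by (simp add: hardy_density_def)
    qed (rule intP)
    also have "\<dots> = integral {x..y} (hardy_density p u u') + h * (A * \<Lambda> h * J / x)"
      using axy p du cont unfolding h_def
      by (subst Henstock_Kurzweil_Integration.integral_add)
        (auto intro!: hardy_density_integrable intro: continuous_on_subset)
    also have "integral {x..y} (hardy_density p u u') \<le> J + A * \<Lambda> h * J"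
      using split1 split2 left right ub by linarith
    also have "h * (A * \<Lambda> h * J / x) \<le> A * \<Lambda> h * J"
      using False h A J Kh axy mult_right_mono[of h x "A * \<Lambda> h * J"] by (simp add: divide_simps mult_ac)
    also have "J + A * \<Lambda> h * J + A * \<Lambda> h * J \<le> (4 powr p * A + 2 * A + 1) * (\<Lambda> h * J)"
    proof -
      have "J \<le> \<Lambda> h * J" using mult_right_mono[OF Kh J] by simp
      moreover have "0 \<le> 4 powr p * A * (\<Lambda> h * J)" using A J Kh by simp
      ultimately show ?thesis by (simp add: algebra_simps)
    qed
    finally have I: "integral {x..y} ?P \<le> (4 powr p * A + 2 * A + 1) * (\<Lambda> h * J)"
      by simp
    have "\<bar>u y - u x\<bar> powr p \<le> h powr (p - 1) * integral {x..y} ?P"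
      unfolding h_def using p axy du cont by (intro jensen_increment) (auto intro: continuous_on_subset)
    also have "\<dots> \<le> h powr (p - 1) * ((4 powr p * A + 2 * A + 1) * (\<Lambda> h * J))"
      using I by (intro mult_left_mono) auto
    finally show ?thesis
      by (simp add: h_def \<Lambda>_def J_def mult_ac abs_minus_commute)
  qed
qed

section \<open>Reflection of the right half, gluing at the midpoint, and the inequality with
  exponent 1/p\<close>

section \<open>Test functions on the whole interval\<close>

lemma test_functionsD:
  assumes "u \<in> test_functions R"
  shows "(u has_real_derivative deriv u x) (at x)" "continuous_on S (deriv u)"
proof -
  have *: "(deriv ^^ n) u differentiable_on UNIV" for n
    using assms by (auto simp: test_functions_def)
  show "(u has_real_derivative deriv u x) (at x)"
    using *[of 0] by (simp add: differentiable_on_def DERIV_deriv_iff_real_differentiable)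
  have "continuous_on UNIV (deriv u)"
    using *[of 1] by (simp add: differentiable_imp_continuous_on)
  then show "continuous_on S (deriv u)"
    by (rule continuous_on_subset) simp
qed

lemma test_functions_vanish_near_boundary:
  assumes "u \<in> test_functions R" "R > 0"
  obtains d where "d > 0" "\<And>x. x < d \<Longrightarrow> u x = 0" "\<And>x. x > R - d \<Longrightarrow> u x = 0"
proof (cases "closure {x. u x \<noteq> 0} = {}")
  case True
  then show ?thesis
    by (intro that[of 1]) auto
next
  case False
  define K where "K = closure {x. u x \<noteq> 0}"
  have K: "compact K" "K \<subseteq> {0<..<R}" "K \<noteq> {}"
    using assms False by (simp_all add: test_functions_def K_def)
  have sub: "x \<in> K" if "u x \<noteq> 0" for x
    using that subsetD[OF closure_subset, of x "{x. u x \<noteq> 0}"] by (simp add: K_def)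
  obtain l where l: "l \<in> K" "\<forall>t\<in>K. l \<le> t"
    using compact_attains_inf[OF K(1,3)] by metis
  obtain r where r: "r \<in> K" "\<forall>t\<in>K. t \<le> r"
    using compact_attains_sup[OF K(1,3)] by metis
  show ?thesis
  proof (rule that[of "min l (R - r)"])
    show "0 < min l (R - r)"
      using subsetD[OF K(2) l(1)] subsetD[OF K(2) r(1)] by simp
    show "u x = 0" if x: "x < min l (R - r)" for x
      using bspec[OF l(2) sub[of x]] x by (cases "u x = 0") auto
    show "u x = 0" if x: "x > R - min l (R - r)" for x
      using bspec[OF r(2) sub[of x]] x by (cases "u x = 0") auto
  qed
qed

lemma integral_reflect_interval:
  fixes f :: "real \<Rightarrow> real"
  shows "integral {R - b..R - a} f = integral {a..b} (\<lambda>x. f (R - x))"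
proof -
  have "integral {R - b..R - a} f = integral {R - b - R..R - a - R} (\<lambda>x. f (x + R))"
    using integral_shift_cbox[of "R - b" R "R - a" f] by simp
  also have "\<dots> = integral {a..b} (\<lambda>x. f (R - x))"
  proof -
    have "integral {- b..- a} (\<lambda>x. f (R - (- x))) = integral {a..b} (\<lambda>x. f (R - x))"
      using Henstock_Kurzweil_Integration.integral_reflect_real[of b a "\<lambda>x. f (R - x)"] .
    moreover have "R - b - R = - b" "R - a - R = - a" "(\<lambda>x. f (x + R)) = (\<lambda>x. f (R - (- x)))"
      by (simp_all add: add.commute)
    ultimately show ?thesis by (simp only:)
  qed
  finally show ?thesis .
qed

lemma LINT_open_interval_continuous:
  fixes f :: "real \<Rightarrow> real"
  assumes "continuous_on {a..b} f"
  shows "(LINT x:{a<..<b}|lborel. f x) = integral {a..b} f"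
proof -
  have "set_integrable lborel {a<..<b} f"
    by (rule set_integrable_subset[OF borel_integrable_atLeastAtMost'[OF assms]]) auto
  then show ?thesis
    by (simp add: set_borel_integral_eq_integral(2) integral_open_interval_real)
qed

text \<open>Near the end points u and its derivative vanish, so only [a, R - a] contributes.
  Reflecting the right half turns it into a second problem on [a, R/2] with singularity at
  0.\<close>

lemma hardy_deficit_split:
  assumes p: "p > 1" and R: "R > 0" and u: "u \<in> test_functions R"
    and a: "0 < a" "a < d" "a < R / 2"
    and d: "\<And>x. x < d \<Longrightarrow> u x = 0" "\<And>x. x > R - d \<Longrightarrow> u x = 0"
  shows "hardy_deficit p R u = integral {a..R / 2} (hardy_density p u (deriv u))
    + integral {a..R / 2} (hardy_density p (\<lambda>x. u (R - x)) (\<lambda>x. - deriv u (R - x)))"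
proof -
  define f where "f = (\<lambda>x. \<bar>deriv u x\<bar> powr p)"
  \<comment> \<open>Truncating the distance at a makes the Hardy integrand continuous up to the
    boundary without changing it, since u = 0 wherever the distance is below a.\<close>
  define g where "g = (\<lambda>x. \<bar>u x\<bar> powr p / max (bdist R x) a powr p)"
  define F where "F = (\<lambda>x. f x - ((p - 1) / p) powr p * g x)"
  have "continuous_on S u" for S
    using test_functionsD(1)[OF u] DERIV_isCont by (blast intro: continuous_at_imp_continuous_on)
  note cont = this test_functionsD(2)[OF u]
  have contf: "continuous_on S f" for S
    unfolding f_def using p by (intro continuous_intros continuous_on_powr' cont) auto
  have contg: "continuous_on S g" for S
    unfolding g_def bdist_def using p a
    by (intro continuous_intros continuous_on_powr' cont) (auto simp: max_def)
  have contF: "continuous_on S F" for S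
    unfolding F_def by (intro continuous_intros contf contg)
  have zero: "u x = 0 \<and> deriv u x = 0" if "x < d \<or> x > R - d" for x
  proof -
    \<comment> \<open>The set where u is known to vanish is open, so the derivative vanishes there
      too.\<close>
    have "eventually (\<lambda>y. y < d \<or> y > R - d) (nhds x)"
      using that eventually_nhds_in_open[of "{..<d}" x] eventually_nhds_in_open[of "{R - d<..}" x]
      by (auto elim: eventually_mono)
    then have "eventually (\<lambda>y. u y = 0) (nhds x)"
      by eventually_elim (use d in auto)
    then have "deriv u x = deriv (\<lambda>_. 0) x"
      by (intro deriv_cong_ev) auto
    then show ?thesis using that d by auto
  qed
  have "(LINT x:{0<..<R}|lborel. \<bar>u x\<bar> powr p / bdist R x powr p) = (LINT x:{0<..<R}|lborel. g x)"
  proof (intro set_lebesgue_integral_cong allI impI)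
    fix x assume "x \<in> {0<..<R}"
    show "\<bar>u x\<bar> powr p / bdist R x powr p = g x"
    proof (cases "bdist R x < a")
      case True
      then have "x < d \<or> x > R - d" using a by (auto simp: bdist_def)
      then have "u x = 0" using zero by blast
      then show ?thesis by (simp add: g_def)
    qed (simp add: g_def max_def)
  qed auto
  then have "hardy_deficit p R u = integral {0..R} f - ((p - 1) / p) powr p * integral {0..R} g"
    using LINT_open_interval_continuous[OF contf, of 0 R] LINT_open_interval_continuous[OF contg, of 0 R]
    by (simp add: hardy_deficit_def f_def)
  also have "\<dots> = integral {0..R} F"
    unfolding F_def using contf contg
    by (subst Henstock_Kurzweil_Integration.integral_diff)
      (auto intro!: integrable_continuous_interval continuous_intros)
  also have "\<dots> = integral {0..a} F + integral {a..R / 2} F + integral {R / 2..R - a} F + integral {R - a..R} F"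
  proof -
    have int: "F integrable_on {s..t}" for s t
      by (intro integrable_continuous_interval contF)
    have "integral {0..a} F + integral {a..R / 2} F = integral {0..R / 2} F"
      by (rule Henstock_Kurzweil_Integration.integral_combine) (use a int in auto)
    moreover have "integral {0..R / 2} F + integral {R / 2..R - a} F = integral {0..R - a} F"
      by (rule Henstock_Kurzweil_Integration.integral_combine) (use a int in auto)
    moreover have "integral {0..R - a} F + integral {R - a..R} F = integral {0..R} F"
      by (rule Henstock_Kurzweil_Integration.integral_combine) (use a int in auto)
    ultimately show ?thesis by simp
  qed
  also have "integral {0..a} F = integral {0..a} (\<lambda>_. 0)"
    by (rule integral_cong) (use zero a p in \<open>auto simp: F_def f_def g_def\<close>)
  also have "integral {R - a..R} F = integral {R - a..R} (\<lambda>_. 0)"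
    by (rule integral_cong) (use zero a p in \<open>auto simp: F_def f_def g_def\<close>)
  also have "integral {R / 2..R - a} F = integral {a..R / 2} (\<lambda>x. F (R - x))"
    using integral_reflect_interval[of R "R / 2" a F] by simp
  also have "integral {a..R / 2} (\<lambda>x. F (R - x)) =
      integral {a..R / 2} (hardy_density p (\<lambda>x. u (R - x)) (\<lambda>x. - deriv u (R - x)))"
  proof (rule integral_cong)
    fix x assume "x \<in> {a..R / 2}"
    then have "max (bdist R (R - x)) a = x" by (auto simp: bdist_def)
    then show "F (R - x) = hardy_density p (\<lambda>x. u (R - x)) (\<lambda>x. - deriv u (R - x)) x"
      by (simp add: F_def f_def g_def hardy_density_def powr_minus divide_inverse)
  qed
  also have "integral {a..R / 2} F = integral {a..R / 2} (hardy_density p u (deriv u))"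
  proof (rule integral_cong)
    fix x assume "x \<in> {a..R / 2}"
    then have "max (bdist R x) a = x" by (auto simp: bdist_def)
    then show "F x = hardy_density p u (deriv u) x"
      by (simp add: F_def f_def g_def hardy_density_def powr_minus divide_inverse)
  qed
  finally show ?thesis by simp
qed

text \<open>Points in one half are handled by the half-interval estimate, directly or after
  reflection; points in different halves are joined through R/2. The triangle inequality through an
  intermediate point costs 2^p.\<close>

lemma test_function_hoelder:
  fixes p R x y :: real
  defines "A \<equiv> p * ((p - 1) / p) powr (1 - p)"
  assumes p: "p > 1" and R: "R > 0" and u: "u \<in> test_functions R" and xy: "0 < x" "x < y" "y < R"
  shows "\<bar>u x - u y\<bar> powr p \<le> 2 powr p * (4 powr p * A + 2 * A + 1) *
    ((y - x) powr (p - 1) * (1 + ln (exp (1 / (p - 1)) * R / (y - x))) * hardy_deficit p R u)"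
    and "hardy_deficit p R u \<ge> 0"
proof -
  define C where "C = 4 powr p * A + 2 * A + 1"
  define L where "L = R / 2"
  define D where "D = exp (1 / (p - 1)) * R"
  define W where "W = (\<lambda>h. h powr (p - 1) * (1 + ln (D / h)))"
  obtain d where d: "d > 0" "\<And>x. x < d \<Longrightarrow> u x = 0" "\<And>x. x > R - d \<Longrightarrow> u x = 0"
    using test_functions_vanish_near_boundary[OF u R] by blast
  \<comment> \<open>The terms ensure in turn that u vanishes at a and at R - a, that x and the
    reflection of y lie to the right of a, and that a < R/2.\<close>
  define a where "a = Min {d / 2, x, R - y, R / 4}"
  have a: "0 < a" "a < d" "a < L" "a \<le> x" "a \<le> R - y"
    using d R xy by (auto simp: a_def L_def min_def)
  define v where "v = (\<lambda>x. u (R - x))"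
  define v' where "v' = (\<lambda>x. - deriv u (R - x))"
  define J1 where "J1 = integral {a..L} (hardy_density p u (deriv u))"
  define J2 where "J2 = integral {a..L} (hardy_density p v v')"
  have du: "(u has_real_derivative deriv u s) (at s)" for s
    by (rule test_functionsD[OF u])
  have dv: "(v has_real_derivative v' s) (at s)" for s
  proof -
    have "(v has_real_derivative deriv u (R - s) * (- 1)) (at s)"
      unfolding v_def by (rule DERIV_chain2[OF du]) (auto intro!: derivative_eq_intros)
    then show ?thesis by (simp add: v'_def)
  qed
  have contv: "continuous_on S v'" for S
    unfolding v'_def
    by (intro continuous_intros continuous_on_compose2[OF test_functionsD(2)[OF u, of UNIV]]) auto
  have ends: "u a = 0" "v a = 0"
    using d a by (auto simp: v_def)
  have deficit: "hardy_deficit p R u = J1 + J2"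
    unfolding J1_def J2_def v_def v'_def L_def using p R u a d
    by (intro hardy_deficit_split) (auto simp: L_def)
  have J: "J1 \<ge> 0" "J2 \<ge> 0"
    unfolding J1_def J2_def using p a du dv contv ends test_functionsD(2)[OF u]
    by (auto intro!: hardy_density_integral_nonneg)
  then show def: "hardy_deficit p R u \<ge> 0" by (simp add: deficit)
  have A: "A > 0" using p by (simp add: A_def)
  have C: "C > 0" using A by (simp add: C_def add_pos_pos)
  have expD: "L * exp (1 / (p - 1)) \<le> D" using R by (simp add: L_def D_def)
  \<comment> \<open>D is built from R rather than R/2, so the weight is monotone for all increments
    up to R.\<close>
  have Wmono: "W s \<le> W t" if "0 < s" "s \<le> t" "t \<le> R" for s t
    unfolding W_def using that p
    by (intro powr_log_weight_mono) (auto simp: D_def mult.commute intro!: mult_right_mono)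
  have W0: "0 \<le> W s" if "0 < s" "s \<le> R" for s
  proof -
    have "1 * R \<le> D" unfolding D_def using R p by (intro mult_right_mono) auto
    then show ?thesis using that by (simp add: W_def)
  qed
  have lift: "C * (W s * J') \<le> C * (W t * hardy_deficit p R u)"
    if "0 < s" "s \<le> t" "t \<le> R" "J' = J1 \<or> J' = J2" for s t J'
    using that C J W0[of t] Wmono[of s t] by (intro mult_left_mono mult_mono) (auto simp: deficit)
  have left: "\<bar>u s - u t\<bar> powr p \<le> C * (W r * hardy_deficit p R u)"
    if "a \<le> s" "s < t" "t \<le> L" "t - s \<le> r" "r \<le> R" for s t r
  proof -
    have "\<bar>u s - u t\<bar> powr p \<le> C * (W (t - s) * J1)"
      unfolding W_def C_def A_def J1_def
      by (rule half_interval_hoelder[OF p a(1) that(1-3) expD du test_functionsD(2)[OF u] ends(1)])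
    also have "\<dots> \<le> C * (W r * hardy_deficit p R u)"
      using that by (intro lift) auto
    finally show ?thesis .
  qed
  have right: "\<bar>v s - v t\<bar> powr p \<le> C * (W r * hardy_deficit p R u)"
    if "a \<le> s" "s < t" "t \<le> L" "t - s \<le> r" "r \<le> R" for s t r
  proof -
    have "\<bar>v s - v t\<bar> powr p \<le> C * (W (t - s) * J2)"
      unfolding W_def C_def A_def J2_def
      by (rule half_interval_hoelder[OF p a(1) that(1-3) expD dv contv ends(2)])
    also have "\<dots> \<le> C * (W r * hardy_deficit p R u)"
      using that by (intro lift) auto
    finally show ?thesis .
  qed
  define T where "T = C * (W (y - x) * hardy_deficit p R u)"
  have T0: "0 \<le> T" using C def W0[of "y - x"] xy by (auto simp: T_def)
  \<comment> \<open>If both points lie in one half, m = y makes the second increment zero; otherwise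
    m is the midpoint.\<close>
  have "\<exists>m. \<bar>u x - u m\<bar> powr p \<le> T \<and> \<bar>u m - u y\<bar> powr p \<le> T"
  proof -
    consider "y \<le> L" | "L \<le> x" | "x < L" "L < y" by linarith
    then show ?thesis
    proof cases
      case 1
      then show ?thesis
        using left[of x y "y - x"] a xy T0 p by (intro exI[of _ y]) (auto simp: T_def)
    next
      case 2
      then show ?thesis
        using right[of "R - y" "R - x" "y - x"] a xy T0 p
        by (intro exI[of _ y]) (auto simp: T_def v_def L_def abs_minus_commute)
    next
      case 3
      then show ?thesis
        using left[of x L "y - x"] right[of "R - y" L "y - x"] a xy
        by (intro exI[of _ L]) (auto simp: T_def v_def L_def abs_minus_commute)
    qed
  qed
  then obtain m where m: "\<bar>u x - u m\<bar> powr p \<le> T" "\<bar>u m - u y\<bar> powr p \<le> T" by blast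
  define M where "M = max \<bar>u x - u m\<bar> \<bar>u m - u y\<bar>"
  have "\<bar>u x - u y\<bar> powr p \<le> (2 * M) powr p"
  proof (intro powr_mono2)
    have "\<bar>u x - u y\<bar> \<le> \<bar>u x - u m\<bar> + \<bar>u m - u y\<bar>"
      using abs_triangle_ineq[of "u x - u m" "u m - u y"] by simp
    also have "\<dots> \<le> M + M"
      unfolding M_def by (intro add_mono max.cobounded1 max.cobounded2)
    finally show "\<bar>u x - u y\<bar> \<le> 2 * M" by simp
  qed (use p in auto)
  also have "\<dots> = 2 powr p * M powr p"
    by (simp add: powr_mult M_def)
  also have "\<dots> \<le> 2 powr p * T"
    using m by (intro mult_left_mono) (auto simp: M_def max_def)
  finally show "\<bar>u x - u y\<bar> powr p \<le> 2 powr p * (4 powr p * A + 2 * A + 1) *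
    ((y - x) powr (p - 1) * (1 + ln (exp (1 / (p - 1)) * R / (y - x))) * hardy_deficit p R u)"
    by (simp add: T_def C_def W_def D_def mult.assoc)
qed

text \<open>This is the p-th root of the previous estimate: the logarithmic factor 1 + ln(bR/h) is
  exactly the reciprocal of X(h/(bR)). With b = exp(1/(p-1)), both constants depend on p
  only.\<close>

lemma hardy_morrey_log_weight:
  fixes p :: real
  assumes p: "p > 1"
  shows "\<exists>b\<ge>1. \<exists>c>0. \<forall>R>0. \<forall>u\<in>test_functions R. hardy_morrey_ineq p (1 / p) b c R u"
proof -
  define A where "A = p * ((p - 1) / p) powr (1 - p)"
  define C where "C = 2 powr p * (4 powr p * A + 2 * A + 1)"
  define b where "b = exp (1 / (p - 1))"
  have A: "A > 0" using p by (simp add: A_def)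
  have C: "C > 0" using A by (simp add: C_def add_pos_pos)
  have b: "b \<ge> 1" using p by (simp add: b_def)
  have "hardy_morrey_ineq p (1 / p) b (C powr (1 / p)) R u"
    if R: "R > 0" and u: "u \<in> test_functions R" for R u
  proof -
    have ordered: "\<bar>u x - u y\<bar> / \<bar>x - y\<bar> powr (1 - 1 / p) * X (\<bar>x - y\<bar> / (b * R)) powr (1 / p)
        \<le> C powr (1 / p) * hardy_deficit p R u powr (1 / p)" if xy: "0 < x" "x < y" "y < R" for x y
    proof -
      define h where "h = y - x"
      define \<Lambda> where "\<Lambda> = 1 + ln (b * R / h)"
      have h: "0 < h" "h < R" using xy by (auto simp: h_def)
      have "1 * R \<le> b * R" using b R by (intro mult_right_mono) auto
      then have "h \<le> b * R" using h by linarith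
      then have \<Lambda>: "\<Lambda> \<ge> 1" using h by (simp add: \<Lambda>_def)
      have X: "X (\<bar>x - y\<bar> / (b * R)) = inverse \<Lambda>"
        using h b R xy by (simp add: X_def \<Lambda>_def h_def ln_div abs_if)
      have def: "hardy_deficit p R u \<ge> 0"
        by (rule test_function_hoelder(2)[OF p R u xy])
      have "\<bar>u x - u y\<bar> powr p \<le> C * (h powr (p - 1) * \<Lambda> * hardy_deficit p R u)"
        using test_function_hoelder(1)[OF p R u xy] by (simp add: C_def A_def h_def \<Lambda>_def b_def)
      then have "(\<bar>u x - u y\<bar> powr p) powr (1 / p) \<le> (C * (h powr (p - 1) * \<Lambda> * hardy_deficit p R u)) powr (1 / p)"
        using p by (intro powr_mono2) auto
      then have "\<bar>u x - u y\<bar> \<le> (C * (h powr (p - 1) * \<Lambda> * hardy_deficit p R u)) powr (1 / p)"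
        using p by (simp add: powr_powr)
      also have "\<dots> = C powr (1 / p) * hardy_deficit p R u powr (1 / p) * (h powr (1 - 1 / p) * \<Lambda> powr (1 / p))"
        using C h \<Lambda> def p by (simp add: powr_mult powr_powr diff_divide_distrib)
      finally have "\<bar>u x - u y\<bar> / (h powr (1 - 1 / p) * \<Lambda> powr (1 / p)) \<le> C powr (1 / p) * hardy_deficit p R u powr (1 / p)"
        using h \<Lambda> by (simp add: field_simps)
      moreover have "\<bar>x - y\<bar> = h" using xy by (simp add: h_def)
      moreover have "X (\<bar>x - y\<bar> / (b * R)) powr (1 / p) = inverse (\<Lambda> powr (1 / p))"
        using X \<Lambda> by (simp add: inverse_powr)
      ultimately show ?thesis
        by (simp add: divide_inverse mult.assoc)
    qed
    show ?thesis
      unfolding hardy_morrey_ineq_def weighted_hoelder_seminorm_def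
    proof (rule SUP_least, clarify)
      fix x y assume xy: "x \<in> {0<..<R}" "y \<in> {0<..<R}" "x \<noteq> y"
      then consider "x < y" | "y < x" by linarith
      then show "ereal (\<bar>u x - u y\<bar> / \<bar>x - y\<bar> powr (1 - 1 / p) * X (\<bar>x - y\<bar> / (b * R)) powr (1 / p))
          \<le> ereal (C powr (1 / p) * hardy_deficit p R u powr (1 / p))"
        by cases (use ordered[of x y] ordered[of y x] xy in \<open>auto simp: abs_minus_commute\<close>)
    qed
  qed
  then show ?thesis
    using b C by (intro exI[of _ b] conjI exI[of _ "C powr (1 / p)"] allI impI ballI) auto
qed

section \<open>Construction of smooth compactly supported functions with exponential cutoffs in ln
  x\<close>

section \<open>Flat bumps in logarithmic scale\<close>

lemma poly_times_exp_bounded: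
  fixes c :: real and k :: nat
  assumes "c > 0"
  obtains C where "C \<ge> 0" "\<And>z. z \<ge> 0 \<Longrightarrow> (1 + z) ^ k * exp (- (c * z)) \<le> C"
proof (rule that[of "(1 + real (k + 1) / c) ^ k"])
  show "(1 + real (k + 1) / c) ^ k \<ge> 0" using assms by simp
next
  fix z :: real assume z: "z \<ge> 0"
  \<comment> \<open>Taking k + 1 keeps the divisor positive when k = 0. Then (1 + z)^k is at most a
    constant times exp(k c z / m), and k/m \<le> 1.\<close>
  define m where "m = real (k + 1)"
  have m: "m > 0" by (simp add: m_def)
  have "1 + z \<le> (1 + m / c) * (1 + c * z / m)"
    using z m assms by (simp add: field_simps)
  also have "\<dots> \<le> (1 + m / c) * exp (c * z / m)"
    using m assms by (intro mult_left_mono exp_ge_add_one_self) auto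
  finally have "(1 + z) ^ k \<le> ((1 + m / c) * exp (c * z / m)) ^ k"
    using z by (intro power_mono) auto
  also have "\<dots> = (1 + m / c) ^ k * exp (real k * (c * z / m))"
    by (simp add: power_mult_distrib flip: exp_of_nat_mult)
  also have "\<dots> \<le> (1 + m / c) ^ k * exp (c * z)"
  proof -
    have "real k * (c * z) \<le> m * (c * z)"
      using assms z by (intro mult_right_mono) (auto simp: m_def)
    then have "real k * (c * z / m) \<le> c * z"
      using m by (simp add: field_simps)
    then show ?thesis using m assms by (intro mult_left_mono) auto
  qed
  finally show "(1 + z) ^ k * exp (- (c * z)) \<le> (1 + real (k + 1) / c) ^ k"
    by (simp add: m_def exp_minus field_simps)
qed

text \<open>It blows up at both ends of (\<alpha>, \<beta>). For \<alpha> = exp(-2N), \<beta> =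
  exp(-N) and \<tau> = -ln x / N, multiplication by N gives 1/(2 - \<tau>) + 1/(\<tau> - 1); hence
  the factor N in the exponent of \<open>log_bump\<close> makes the cutoff a fixed bump in
  \<tau>.\<close>

definition log_barrier :: "real \<Rightarrow> real \<Rightarrow> real \<Rightarrow> real" where
  "log_barrier \<alpha> \<beta> x = 1 / ln (x / \<alpha>) + 1 / ln (\<beta> / x)"

definition log_bump :: "real \<Rightarrow> real \<Rightarrow> real \<Rightarrow> (real \<Rightarrow> real) \<Rightarrow> real \<Rightarrow> real" where
  "log_bump N \<alpha> \<beta> h x = (if \<alpha> < x \<and> x < \<beta> then h x * exp (- (N * log_barrier \<alpha> \<beta> x)) else 0)"

text \<open>This class of coefficients is closed under differentiation on \<open>(\<alpha>, \<beta>)\<close>, so all derivatives of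
  \<^const>\<open>log_bump\<close> are again of the same form; the exponential beats any of them at the end points.\<close>

inductive bump_coeff :: "real \<Rightarrow> real \<Rightarrow> (real \<Rightarrow> real) \<Rightarrow> bool" for \<alpha> \<beta> where
  const: "bump_coeff \<alpha> \<beta> (\<lambda>x. c)"
| powr: "bump_coeff \<alpha> \<beta> (\<lambda>x. x powr r)"
| left: "bump_coeff \<alpha> \<beta> (\<lambda>x. 1 / ln (x / \<alpha>))"
| right: "bump_coeff \<alpha> \<beta> (\<lambda>x. 1 / ln (\<beta> / x))"
| add: "bump_coeff \<alpha> \<beta> f \<Longrightarrow> bump_coeff \<alpha> \<beta> g \<Longrightarrow> bump_coeff \<alpha> \<beta> (\<lambda>x. f x + g x)"
| mult: "bump_coeff \<alpha> \<beta> f \<Longrightarrow> bump_coeff \<alpha> \<beta> g \<Longrightarrow> bump_coeff \<alpha> \<beta> (\<lambda>x. f x * g x)"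

text \<open>The derivatives are polynomials in the generators of \<open>bump_coeff\<close>, which is
  the reason that class is closed under differentiation.\<close>

lemma log_barrier_terms:
  fixes \<alpha> \<beta> x :: real
  assumes "0 < \<alpha>" "\<alpha> < x" "x < \<beta>"
  shows "1 / ln (x / \<alpha>) > 0" "1 / ln (\<beta> / x) > 0" "log_barrier \<alpha> \<beta> x > 0"
    and "((\<lambda>x. 1 / ln (x / \<alpha>)) has_real_derivative - (x powr - 1 * (1 / ln (x / \<alpha>))\<^sup>2)) (at x)"
    and "((\<lambda>x. 1 / ln (\<beta> / x)) has_real_derivative x powr - 1 * (1 / ln (\<beta> / x))\<^sup>2) (at x)"
proof -
  show pos: "1 / ln (x / \<alpha>) > 0" "1 / ln (\<beta> / x) > 0"
    using assms by auto
  then show "log_barrier \<alpha> \<beta> x > 0"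
    unfolding log_barrier_def by (rule add_pos_pos)
  show "((\<lambda>x. 1 / ln (x / \<alpha>)) has_real_derivative - (x powr - 1 * (1 / ln (x / \<alpha>))\<^sup>2)) (at x)"
    using assms pos by (auto intro!: derivative_eq_intros simp: powr_minus divide_simps power2_eq_square)
  show "((\<lambda>x. 1 / ln (\<beta> / x)) has_real_derivative x powr - 1 * (1 / ln (\<beta> / x))\<^sup>2) (at x)"
    using assms pos by (auto intro!: derivative_eq_intros simp: powr_minus divide_simps power2_eq_square)
qed

lemma bump_coeff_deriv:
  assumes "bump_coeff \<alpha> \<beta> h" "0 < \<alpha>"
  obtains h' where "bump_coeff \<alpha> \<beta> h'"
    "\<And>x. \<alpha> < x \<Longrightarrow> x < \<beta> \<Longrightarrow> (h has_real_derivative h' x) (at x)"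
proof -
  have "\<exists>h'. bump_coeff \<alpha> \<beta> h' \<and> (\<forall>x. \<alpha> < x \<longrightarrow> x < \<beta> \<longrightarrow> (h has_real_derivative h' x) (at x))"
    using assms(1)
  proof induction
    case (const c)
    show ?case
      by (intro exI[of _ "\<lambda>x. 0"] conjI bump_coeff.const) auto
  next
    case (powr r)
    show ?case
      by (rule exI[of _ "\<lambda>x. r * x powr (r - 1)"])
        (use assms(2) in \<open>auto intro!: bump_coeff.intros derivative_eq_intros\<close>)
  next
    case left
    show ?case
      by (rule exI[of _ "\<lambda>x. - 1 * (x powr - 1 * (1 / ln (x / \<alpha>) * (1 / ln (x / \<alpha>))))"], intro conjI allI impI)
        (intro bump_coeff.intros, use log_barrier_terms(4)[OF assms(2)] in \<open>simp add: power2_eq_square\<close>)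
  next
    case right
    show ?case
      by (rule exI[of _ "\<lambda>x. x powr - 1 * (1 / ln (\<beta> / x) * (1 / ln (\<beta> / x)))"], intro conjI allI impI)
        (intro bump_coeff.intros, use log_barrier_terms(5)[OF assms(2)] in \<open>simp add: power2_eq_square\<close>)
  next
    case (add f g)
    then obtain f' g' where "bump_coeff \<alpha> \<beta> f'" "bump_coeff \<alpha> \<beta> g'"
      "\<forall>x. \<alpha> < x \<longrightarrow> x < \<beta> \<longrightarrow> (f has_real_derivative f' x) (at x)"
      "\<forall>x. \<alpha> < x \<longrightarrow> x < \<beta> \<longrightarrow> (g has_real_derivative g' x) (at x)" by blast
    then show ?case
      by (intro exI[of _ "\<lambda>x. f' x + g' x"]) (auto intro!: bump_coeff.add DERIV_add)
  next
    case (mult f g)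
    then obtain f' g' where "bump_coeff \<alpha> \<beta> f'" "bump_coeff \<alpha> \<beta> g'"
      "\<forall>x. \<alpha> < x \<longrightarrow> x < \<beta> \<longrightarrow> (f has_real_derivative f' x) (at x)"
      "\<forall>x. \<alpha> < x \<longrightarrow> x < \<beta> \<longrightarrow> (g has_real_derivative g' x) (at x)" by blast
    with mult show ?case
      by (intro exI[of _ "\<lambda>x. f' x * g x + g' x * f x"])
        (auto intro!: bump_coeff.add bump_coeff.mult DERIV_mult)
  qed
  with that show ?thesis by blast
qed

text \<open>Powers of x are bounded because \<alpha> > 0, and each reciprocal logarithm is a summand
  of the barrier. Since 1 plus the barrier is at least 1, the degree k + k' serves for sums as well
  as for products.\<close>

lemma bump_coeff_bound:
  assumes "bump_coeff \<alpha> \<beta> h" "0 < \<alpha>"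
  obtains C k where "C \<ge> 0"
    "\<And>x. \<alpha> < x \<Longrightarrow> x < \<beta> \<Longrightarrow> \<bar>h x\<bar> \<le> C * (1 + log_barrier \<alpha> \<beta> x) ^ k"
proof -
  note terms = log_barrier_terms[OF assms(2)]
  have "\<exists>C k. C \<ge> 0 \<and> (\<forall>x. \<alpha> < x \<longrightarrow> x < \<beta> \<longrightarrow> \<bar>h x\<bar> \<le> C * (1 + log_barrier \<alpha> \<beta> x) ^ k)"
    using assms(1)
  proof induction
    case (const c)
    show ?case by (intro exI[of _ "\<bar>c\<bar>"] exI[of _ 0]) auto
  next
    case (powr r)
    have "x powr r \<le> \<alpha> powr r + \<beta> powr r" if "\<alpha> < x" "x < \<beta>" for x
    proof (cases "r \<ge> 0")
      case True
      then have "x powr r \<le> \<beta> powr r" using that assms(2) by (intro powr_mono2) auto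
      then show ?thesis by (simp add: add_increasing)
    next
      case False
      then have "x powr r \<le> \<alpha> powr r" using that assms(2) by (intro powr_mono2') auto
      then show ?thesis by (simp add: add_increasing2)
    qed
    then show ?case by (intro exI[of _ "\<alpha> powr r + \<beta> powr r"] exI[of _ 0]) auto
  next
    case left
    show ?case
    proof (intro exI[of _ 1] conjI allI impI)
      fix x assume "\<alpha> < x" "x < \<beta>"
      with terms(1,2)[OF this] show "\<bar>1 / ln (x / \<alpha>)\<bar> \<le> 1 * (1 + log_barrier \<alpha> \<beta> x) ^ 1"
        unfolding log_barrier_def by (simp only: abs_of_pos) simp
    qed simp
  next
    case right
    show ?case
    proof (intro exI[of _ 1] conjI allI impI)
      fix x assume "\<alpha> < x" "x < \<beta>"
      with terms(1,2)[OF this] show "\<bar>1 / ln (\<beta> / x)\<bar> \<le> 1 * (1 + log_barrier \<alpha> \<beta> x) ^ 1"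
        unfolding log_barrier_def by (simp only: abs_of_pos) simp
    qed simp
  next
    case (add f g)
    then obtain C k C' k' where *: "C \<ge> 0" "C' \<ge> 0"
      "\<forall>x. \<alpha> < x \<longrightarrow> x < \<beta> \<longrightarrow> \<bar>f x\<bar> \<le> C * (1 + log_barrier \<alpha> \<beta> x) ^ k"
      "\<forall>x. \<alpha> < x \<longrightarrow> x < \<beta> \<longrightarrow> \<bar>g x\<bar> \<le> C' * (1 + log_barrier \<alpha> \<beta> x) ^ k'" by blast
    show ?case
    proof (intro exI[of _ "C + C'"] exI[of _ "k + k'"] conjI allI impI)
      fix x assume x: "\<alpha> < x" "x < \<beta>"
      let ?z = "1 + log_barrier \<alpha> \<beta> x"
      have z: "1 \<le> ?z" using terms(3)[OF x] by simp
      have "\<bar>f x + g x\<bar> \<le> C * ?z ^ k + C' * ?z ^ k'"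
        using *(3,4) x by (intro order_trans[OF abs_triangle_ineq] add_mono) auto
      also have "\<dots> \<le> C * ?z ^ (k + k') + C' * ?z ^ (k + k')"
        using * z by (intro add_mono mult_left_mono power_increasing) auto
      finally show "\<bar>f x + g x\<bar> \<le> (C + C') * ?z ^ (k + k')" by (simp add: distrib_right)
    qed (use * in auto)
  next
    case (mult f g)
    then obtain C k C' k' where *: "C \<ge> 0" "C' \<ge> 0"
      "\<forall>x. \<alpha> < x \<longrightarrow> x < \<beta> \<longrightarrow> \<bar>f x\<bar> \<le> C * (1 + log_barrier \<alpha> \<beta> x) ^ k"
      "\<forall>x. \<alpha> < x \<longrightarrow> x < \<beta> \<longrightarrow> \<bar>g x\<bar> \<le> C' * (1 + log_barrier \<alpha> \<beta> x) ^ k'" by blast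
    show ?case
    proof (intro exI[of _ "C * C'"] exI[of _ "k + k'"] conjI allI impI)
      fix x assume x: "\<alpha> < x" "x < \<beta>"
      let ?z = "1 + log_barrier \<alpha> \<beta> x"
      have z: "1 \<le> ?z" using terms(3)[OF x] by simp
      have "\<bar>f x * g x\<bar> \<le> (C * ?z ^ k) * (C' * ?z ^ k')"
        using *(1,3,4) x z unfolding abs_mult by (intro mult_mono) auto
      then show "\<bar>f x * g x\<bar> \<le> (C * C') * ?z ^ (k + k')" by (simp add: power_add mult_ac)
    qed (use * in auto)
  qed
  with that show ?thesis by blast
qed

text \<open>1/(1 + barrier) is at most ln(x/\<alpha>) and at most ln(\<beta>/x), hence at most the
  distance to either end divided by \<alpha>. Since the exponential absorbs every power of the
  barrier, a square of this small quantity can be extracted.\<close>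

lemma log_bump_flat:
  assumes h: "bump_coeff \<alpha> \<beta> h" and \<alpha>: "0 < \<alpha>" and N: "N > 0"
  obtains C where "\<And>x. \<bar>log_bump N \<alpha> \<beta> h x\<bar> \<le> C * (x - \<alpha>)\<^sup>2" "\<And>x. \<bar>log_bump N \<alpha> \<beta> h x\<bar> \<le> C * (x - \<beta>)\<^sup>2"
proof -
  obtain C k where C: "C \<ge> 0"
    "\<And>x. \<alpha> < x \<Longrightarrow> x < \<beta> \<Longrightarrow> \<bar>h x\<bar> \<le> C * (1 + log_barrier \<alpha> \<beta> x) ^ k"
    using bump_coeff_bound[OF h \<alpha>] by blast
  \<comment> \<open>Two powers beyond the growth k of the coefficient produce the quadratic decay at
    the ends.\<close>
  obtain B where B: "B \<ge> 0" "\<And>z. z \<ge> 0 \<Longrightarrow> (1 + z) ^ (k + 2) * exp (- (N * z)) \<le> B"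
    using poly_times_exp_bounded[OF N] by blast
  have main: "\<bar>log_bump N \<alpha> \<beta> h x\<bar> \<le> C * B * (1 / (1 + log_barrier \<alpha> \<beta> x))\<^sup>2"
      "1 / (1 + log_barrier \<alpha> \<beta> x) \<ge> 0"
      "1 / (1 + log_barrier \<alpha> \<beta> x) \<le> (x - \<alpha>) / \<alpha>"
      "1 / (1 + log_barrier \<alpha> \<beta> x) \<le> (\<beta> - x) / \<alpha>"
    if x: "\<alpha> < x" "x < \<beta>" for x
  proof -
    note terms = log_barrier_terms[OF \<alpha> x]
    let ?z = "log_barrier \<alpha> \<beta> x"
    have "\<bar>log_bump N \<alpha> \<beta> h x\<bar> = \<bar>h x\<bar> * exp (- (N * ?z))"
      using x by (simp add: log_bump_def abs_mult)
    also have "\<dots> \<le> C * (1 + ?z) ^ k * exp (- (N * ?z))"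
      using C(2)[OF x] by (intro mult_right_mono) auto
    also have "\<dots> = C * ((1 + ?z) ^ (k + 2) * exp (- (N * ?z))) * (1 / (1 + ?z))\<^sup>2"
      using terms(3) by (simp add: power_add power_divide power2_eq_square add_pos_pos[THEN less_imp_neq, symmetric])
    also have "\<dots> \<le> C * B * (1 / (1 + ?z))\<^sup>2"
      using B(2)[of ?z] terms(3) C(1) by (intro mult_right_mono mult_left_mono) auto
    finally show "\<bar>log_bump N \<alpha> \<beta> h x\<bar> \<le> C * B * (1 / (1 + ?z))\<^sup>2" .
    show "1 / (1 + ?z) \<ge> 0" using terms(3) by simp
    have "1 / (1 + ?z) \<le> 1 / (1 / ln (x / \<alpha>))"
      using terms(1,2) unfolding log_barrier_def by (intro divide_left_mono) (auto intro!: divide_pos_pos add_pos_pos)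
    also have "\<dots> = ln (x / \<alpha>)" by simp
    also have "\<dots> \<le> x / \<alpha> - 1" using x \<alpha> by (intro ln_le_minus_one) auto
    finally show "1 / (1 + ?z) \<le> (x - \<alpha>) / \<alpha>" using \<alpha> by (simp add: field_simps)
    have "1 / (1 + ?z) \<le> 1 / (1 / ln (\<beta> / x))"
      using terms(1,2) unfolding log_barrier_def by (intro divide_left_mono) (auto intro!: divide_pos_pos add_pos_pos)
    also have "\<dots> = ln (\<beta> / x)" by simp
    also have "\<dots> \<le> \<beta> / x - 1" using x \<alpha> by (intro ln_le_minus_one) auto
    also have "\<dots> = (\<beta> - x) / x" using x \<alpha> by (simp add: field_simps)
    also have "\<dots> \<le> (\<beta> - x) / \<alpha>" using x \<alpha> by (intro divide_left_mono) auto
    finally show "1 / (1 + ?z) \<le> (\<beta> - x) / \<alpha>" .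
  qed
  have CB: "0 \<le> C * B" using B(1) C(1) by simp
  have bound: "\<bar>log_bump N \<alpha> \<beta> h x\<bar> \<le> C * B / \<alpha>\<^sup>2 * (x - c)\<^sup>2" if "c = \<alpha> \<or> c = \<beta>" for x c
  proof (cases "\<alpha> < x \<and> x < \<beta>")
    case True
    then have "\<bar>log_bump N \<alpha> \<beta> h x\<bar> \<le> C * B * (1 / (1 + log_barrier \<alpha> \<beta> x))\<^sup>2"
      using main(1) by blast
    also have "\<dots> \<le> C * B * (\<bar>x - c\<bar> / \<alpha>)\<^sup>2"
      using main(2-4)[of x] True that CB by (intro mult_left_mono power_mono) auto
    also have "\<dots> = C * B / \<alpha>\<^sup>2 * (x - c)\<^sup>2" by (simp add: power_divide)
    finally show ?thesis .
  next
    case False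
    then show ?thesis using CB by (auto simp: log_bump_def)
  qed
  show ?thesis
    by (rule that[of "C * B / \<alpha>\<^sup>2"]) (use bound in auto)
qed

lemma has_real_derivative_zero_if_quadratic_bound:
  fixes f :: "real \<Rightarrow> real"
  assumes "\<And>y. \<bar>f y\<bar> \<le> C * (y - x)\<^sup>2"
  shows "(f has_real_derivative 0) (at x)"
proof -
  have "f x = 0" using assms[of x] by simp
  moreover have "((\<lambda>h. f (x + h) / h) \<longlongrightarrow> 0) (at 0)"
  proof (rule tendsto_0_le[where K = C])
    show "((\<lambda>h::real. h) \<longlongrightarrow> 0) (at 0)" by (rule tendsto_ident_at)
    show "\<forall>\<^sub>F h in at 0. norm (f (x + h) / h) \<le> norm h * C"
      using assms[of "x + _"]
      by (intro always_eventually allI) (auto simp: divide_simps power2_eq_square abs_mult mult_ac)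
  qed
  ultimately show ?thesis by (simp add: DERIV_def)
qed

text \<open>Inside the interval this is the product rule, outside the function is locally zero, and
  at the two ends quadratic flatness gives derivative 0. The derivative is again a
  \<open>log_bump\<close> on the whole line.\<close>

lemma log_bump_deriv:
  assumes h: "bump_coeff \<alpha> \<beta> h" and \<alpha>: "0 < \<alpha>" and N: "N > 0"
    and dh: "bump_coeff \<alpha> \<beta> h'" "\<And>x. \<alpha> < x \<Longrightarrow> x < \<beta> \<Longrightarrow> (h has_real_derivative h' x) (at x)"
  shows "(log_bump N \<alpha> \<beta> h has_real_derivative log_bump N \<alpha> \<beta>
    (\<lambda>x. h' x + h x * (N * (x powr - 1 * ((1 / ln (x / \<alpha>))\<^sup>2 - (1 / ln (\<beta> / x))\<^sup>2)))) x) (at x)"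
    (is "(_ has_real_derivative log_bump N \<alpha> \<beta> ?g x) _")
proof -
  consider "\<alpha> < x" "x < \<beta>" | "x < \<alpha> \<or> \<beta> < x" | "x = \<alpha> \<or> x = \<beta>" by linarith
  then show ?thesis
  proof cases
    case 1
    have "((\<lambda>x. h x * exp (- (N * (1 / ln (x / \<alpha>) + 1 / ln (\<beta> / x))))) has_real_derivative
        h' x * exp (- (N * (1 / ln (x / \<alpha>) + 1 / ln (\<beta> / x)))) +
        exp (- (N * (1 / ln (x / \<alpha>) + 1 / ln (\<beta> / x)))) *
          (- (N * (- (x powr - 1 * (1 / ln (x / \<alpha>))\<^sup>2) + x powr - 1 * (1 / ln (\<beta> / x))\<^sup>2))) * h x) (at x)"
      by (intro DERIV_mult dh(2)[OF 1] DERIV_fun_exp DERIV_minus DERIV_cmult DERIV_add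
          log_barrier_terms(4,5)[OF \<alpha> 1])
    also have "h' x * exp (- (N * (1 / ln (x / \<alpha>) + 1 / ln (\<beta> / x)))) +
        exp (- (N * (1 / ln (x / \<alpha>) + 1 / ln (\<beta> / x)))) *
          (- (N * (- (x powr - 1 * (1 / ln (x / \<alpha>))\<^sup>2) + x powr - 1 * (1 / ln (\<beta> / x))\<^sup>2))) * h x
        = log_bump N \<alpha> \<beta> ?g x"
      using 1 by (simp add: log_bump_def log_barrier_def algebra_simps)
    finally have "((\<lambda>x. h x * exp (- (N * (1 / ln (x / \<alpha>) + 1 / ln (\<beta> / x))))) has_real_derivative
        log_bump N \<alpha> \<beta> ?g x) (at x)" .
    moreover have "\<forall>\<^sub>F y in nhds x. y \<in> {\<alpha><..<\<beta>}"
      using 1 by (intro eventually_nhds_in_open) auto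
    then have "\<forall>\<^sub>F y in nhds x. log_bump N \<alpha> \<beta> h y = h y * exp (- (N * (1 / ln (y / \<alpha>) + 1 / ln (\<beta> / y))))"
      by eventually_elim (auto simp: log_bump_def log_barrier_def)
    ultimately show ?thesis
      by (subst DERIV_cong_ev[OF refl _ refl])
  next
    case 2
    then have "\<forall>\<^sub>F y in nhds x. y \<in> {..<\<alpha>} \<union> {\<beta><..}"
      by (intro eventually_nhds_in_open) auto
    then have "\<forall>\<^sub>F y in nhds x. log_bump N \<alpha> \<beta> h y = 0"
      by eventually_elim (auto simp: log_bump_def)
    moreover have "log_bump N \<alpha> \<beta> ?g x = 0" using 2 by (auto simp: log_bump_def)
    ultimately show ?thesis
      by (subst DERIV_cong_ev[OF refl _ refl, where g = "\<lambda>_. 0"]) auto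
  next
    case 3
    obtain C where C: "\<And>x. \<bar>log_bump N \<alpha> \<beta> h x\<bar> \<le> C * (x - \<alpha>)\<^sup>2" "\<And>x. \<bar>log_bump N \<alpha> \<beta> h x\<bar> \<le> C * (x - \<beta>)\<^sup>2"
      using log_bump_flat[OF h \<alpha> N] by blast
    have "(log_bump N \<alpha> \<beta> h has_real_derivative 0) (at x)"
      using 3 C by (intro has_real_derivative_zero_if_quadratic_bound[of _ C]) auto
    moreover have "log_bump N \<alpha> \<beta> ?g x = 0" using 3 by (auto simp: log_bump_def)
    ultimately show ?thesis by simp
  qed
qed

text \<open>By induction each iterated derivative is a \<open>log_bump\<close> with some coefficient
  in the class, hence differentiable everywhere; the support lies in [\<alpha>, \<beta>].\<close>

lemma log_bump_test_function:
  assumes h: "bump_coeff \<alpha> \<beta> h" and \<alpha>: "0 < \<alpha>" and N: "N > 0" and \<beta>: "\<beta> < R"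
  shows "log_bump N \<alpha> \<beta> h \<in> test_functions R"
proof -
  have step: "\<exists>g. bump_coeff \<alpha> \<beta> g \<and> (\<forall>x. (log_bump N \<alpha> \<beta> h has_real_derivative log_bump N \<alpha> \<beta> g x) (at x))"
    if h: "bump_coeff \<alpha> \<beta> h" for h
  proof -
    obtain h' where h': "bump_coeff \<alpha> \<beta> h'"
      "\<And>x. \<alpha> < x \<Longrightarrow> x < \<beta> \<Longrightarrow> (h has_real_derivative h' x) (at x)"
      using bump_coeff_deriv[OF h \<alpha>] by blast
    have "bump_coeff \<alpha> \<beta> (\<lambda>x. h' x + h x * (N * (x powr - 1 *
        ((1 / ln (x / \<alpha>)) * (1 / ln (x / \<alpha>)) + - 1 * ((1 / ln (\<beta> / x)) * (1 / ln (\<beta> / x)))))))"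
      by (intro bump_coeff.intros h h')
    then have "bump_coeff \<alpha> \<beta> (\<lambda>x. h' x + h x * (N * (x powr - 1 *
        ((1 / ln (x / \<alpha>))\<^sup>2 - (1 / ln (\<beta> / x))\<^sup>2))))"
      by (simp add: power2_eq_square)
    with log_bump_deriv[OF h \<alpha> N h'] show ?thesis by blast
  qed
  have "\<exists>g. bump_coeff \<alpha> \<beta> g \<and> (deriv ^^ n) (log_bump N \<alpha> \<beta> h) = log_bump N \<alpha> \<beta> g" for n
  proof (induction n)
    case 0
    then show ?case using h by auto
  next
    case (Suc n)
    then obtain g where g: "bump_coeff \<alpha> \<beta> g" "(deriv ^^ n) (log_bump N \<alpha> \<beta> h) = log_bump N \<alpha> \<beta> g"
      by blast
    obtain g' where "bump_coeff \<alpha> \<beta> g'"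
      "\<forall>x. (log_bump N \<alpha> \<beta> g has_real_derivative log_bump N \<alpha> \<beta> g' x) (at x)"
      using step[OF g(1)] by blast
    moreover from this have "deriv (log_bump N \<alpha> \<beta> g) = log_bump N \<alpha> \<beta> g'"
      by (auto intro: DERIV_imp_deriv)
    ultimately show ?case using g(2) by auto
  qed
  then have "(deriv ^^ n) (log_bump N \<alpha> \<beta> h) differentiable_on UNIV" for n
    using step by (metis differentiable_at_imp_differentiable_on real_differentiable_def)
  moreover have supp: "closure {x. log_bump N \<alpha> \<beta> h x \<noteq> 0} \<subseteq> {\<alpha>..\<beta>}"
    by (rule closure_minimal) (auto simp: log_bump_def split: if_splits)
  moreover from supp have "compact (closure {x. log_bump N \<alpha> \<beta> h x \<noteq> 0})"
    by (meson bounded_closed_interval bounded_subset closed_closure compact_eq_bounded_closed)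
  ultimately show ?thesis
    using \<alpha> \<beta> by (auto simp: test_functions_def)
qed

section \<open>Deficit of the bump functions and failure of the inequality for q < 1/p\<close>

section \<open>Optimality of the exponent\<close>

text \<open>The remainder is quadratic for small t and of order |t|^p for large t. Replacing p by an
  integer k at least p keeps the bound polynomial, so that the exponential cutoff can absorb
  it.\<close>

lemma abs_one_plus_powr_le:
  fixes p t :: real and k :: nat
  assumes p: "p > 1" and k: "k \<ge> 2" "p \<le> real k"
  defines "C \<equiv> p\<^sup>2 + (p + 1) powr p * (p\<^sup>2 + 1)"
  shows "\<bar>1 + t\<bar> powr p - 1 - p * t \<le> C * (t\<^sup>2 + \<bar>t\<bar> ^ k)"
proof (cases "- 1 \<le> t \<and> p * t \<le> 1")
  case True
  \<comment> \<open>From 1 + t \<le> exp t the task is reduced to bounding exp(pt) by its quadratic,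
    which is valid for pt \<le> 1.\<close>
  have "\<bar>1 + t\<bar> powr p \<le> exp t powr p"
    using True p exp_ge_add_one_self[of t] by (intro powr_mono2) auto
  also have "\<dots> = exp (p * t)" by (simp add: powr_def mult.commute)
  also have "\<dots> \<le> 1 + p * t + (p * t)\<^sup>2"
  proof (cases "t \<ge> 0")
    case True
    with \<open>- 1 \<le> t \<and> p * t \<le> 1\<close> p show ?thesis by (intro exp_bound) auto
  next
    case False
    define z where "z = - (p * t)"
    have z: "z \<ge> 0" using False p by (simp add: z_def mult_le_0_iff)
    have "1 \<le> (1 - z + z\<^sup>2) * (1 + z)"
      using zero_le_power[OF z, of 3] by (simp add: algebra_simps power2_eq_square power3_eq_cube)
    then have "inverse (1 + z) \<le> 1 - z + z\<^sup>2"
      using z by (simp add: field_simps)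
    moreover have "exp (- z) \<le> inverse (1 + z)"
      using z unfolding exp_minus by (intro le_imp_inverse_le exp_ge_add_one_self) auto
    ultimately show ?thesis by (simp add: z_def)
  qed
  finally have "\<bar>1 + t\<bar> powr p - 1 - p * t \<le> p\<^sup>2 * t\<^sup>2"
    by (simp add: power_mult_distrib)
  also have "\<dots> \<le> C * (t\<^sup>2 + \<bar>t\<bar> ^ k)"
    by (intro mult_mono) (auto simp: C_def)
  finally show ?thesis .
next
  case False
  \<comment> \<open>Away from the origin 1 \<le> p |t|, so the constant and linear terms are
    dominated by p^2 t^2.\<close>
  have big: "1 \<le> p * \<bar>t\<bar>"
  proof (cases "t \<ge> 0")
    case False
    with \<open>\<not> (- 1 \<le> t \<and> p * t \<le> 1)\<close> p have "1 < \<bar>t\<bar>"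
      using mult_nonneg_nonpos[of p t] by auto
    then show ?thesis using p mult_mono[of 1 p 1 "\<bar>t\<bar>"] by simp
  qed (use \<open>\<not> (- 1 \<le> t \<and> p * t \<le> 1)\<close> in auto)
  have sq: "1 \<le> p\<^sup>2 * t\<^sup>2"
    using power_mono[OF big, of 2] by (simp add: power_mult_distrib)
  have "p * \<bar>t\<bar> \<le> (p * \<bar>t\<bar>) * (p * \<bar>t\<bar>)"
    using big p by (intro mult_le_cancel_left1[THEN iffD2]) auto
  also have "\<dots> = p\<^sup>2 * t\<^sup>2"
    by (simp add: power2_eq_square)
  finally have lin: "- (p * t) \<le> p\<^sup>2 * t\<^sup>2"
    using p mult_left_mono[of "- t" "\<bar>t\<bar>" p] abs_ge_minus_self[of t] by simp
  have tp: "\<bar>t\<bar> powr p \<le> p\<^sup>2 * t\<^sup>2 + \<bar>t\<bar> ^ k"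
  proof (cases "\<bar>t\<bar> \<le> 1")
    case True
    then have "\<bar>t\<bar> powr p \<le> 1" using p by (intro powr_le1) auto
    then show ?thesis using sq by (simp add: add_increasing2)
  next
    case False
    then have "\<bar>t\<bar> powr p \<le> \<bar>t\<bar> powr real k" using k by (intro powr_mono) auto
    then show ?thesis using False by (simp add: powr_realpow add_increasing)
  qed
  have "\<bar>1 + t\<bar> \<le> (p + 1) * \<bar>t\<bar>"
    using big by (simp add: distrib_right)
  then have "\<bar>1 + t\<bar> powr p \<le> ((p + 1) * \<bar>t\<bar>) powr p"
    using p by (intro powr_mono2) auto
  also have "\<dots> = (p + 1) powr p * \<bar>t\<bar> powr p"
    using p by (simp add: powr_mult)
  also have "\<dots> \<le> (p + 1) powr p * (p\<^sup>2 * t\<^sup>2 + \<bar>t\<bar> ^ k)"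
    using tp by (intro mult_left_mono) auto
  also have "\<dots> \<le> (p + 1) powr p * ((p\<^sup>2 + 1) * (t\<^sup>2 + \<bar>t\<bar> ^ k))"
    by (intro mult_left_mono) (auto simp: distrib_left distrib_right)
  finally have "\<bar>1 + t\<bar> powr p - 1 - p * t \<le> (p + 1) powr p * ((p\<^sup>2 + 1) * (t\<^sup>2 + \<bar>t\<bar> ^ k)) + p\<^sup>2 * t\<^sup>2"
    using lin by linarith
  also have "\<dots> \<le> C * (t\<^sup>2 + \<bar>t\<bar> ^ k)"
    by (simp add: C_def distrib_right distrib_left)
  finally show ?thesis .
qed

text \<open>The power x^H is the positive solution of the Euler-Lagrange equation of the Hardy
  functional. The cutoff depends only on -ln x / N and lives on the range (1, 2) of that
  variable.\<close>

definition hardy_bump :: "real \<Rightarrow> real \<Rightarrow> real \<Rightarrow> real" where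
  "hardy_bump p N = log_bump N (exp (- (2 * N))) (exp (- N)) (\<lambda>x. x powr ((p - 1) / p))"

text \<open>With \<open>u = x powr H * v\<close> the first-order term of the density
  is an exact derivative, and each derivative of \<open>v\<close>
  in the variable \<open>ln x\<close> costs a factor \<open>1 / N\<close>.\<close>

lemma hardy_bump_density:
  fixes p :: real
  assumes p: "p > 1"
  obtains K where "K \<ge> 0"
    "\<And>N s. N \<ge> 1 \<Longrightarrow> exp (- (2 * N)) < s \<Longrightarrow> s < exp (- N) \<Longrightarrow>
      hardy_density p (hardy_bump p N) (deriv (hardy_bump p N)) s \<le>
      - (p * ((p - 1) / p) powr p * s powr - p) * \<bar>hardy_bump p N s\<bar> powr p +
      (p * \<bar>hardy_bump p N s\<bar> powr (p - 1) * sgn (hardy_bump p N s) * deriv (hardy_bump p N) s) *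
        (((p - 1) / p) powr (p - 1) * s powr (1 - p)) + K / N\<^sup>2 * (1 / s)"
proof -
  define H where "H = (p - 1) / p"
  have H: "0 < H" "H < 1" "p * H = p - 1" using p by (auto simp: H_def)
  obtain k :: nat where k: "k \<ge> 2" "p \<le> real k"
    using real_arch_simple[of "max p 2"] by auto
  define C where "C = p\<^sup>2 + (p + 1) powr p * (p\<^sup>2 + 1)"
  have C: "C \<ge> 0" by (simp add: C_def)
  obtain B where B: "B \<ge> 0" "\<And>z. z \<ge> 0 \<Longrightarrow> (1 + z) ^ (2 * k) * exp (- (p * z)) \<le> B"
    using poly_times_exp_bounded[of p "2 * k"] p by auto
  define K where "K = C * (2 * (1 / H) ^ k * B)"
  have K: "K \<ge> 0" using C B H by (simp add: K_def)
  show ?thesis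
  proof (rule that[OF K])
    fix N s :: real assume N: "N \<ge> 1" and s: "exp (- (2 * N)) < s" "s < exp (- N)"
    define w1 w2 z where "w1 = 1 / ln (s / exp (- (2 * N)))" and "w2 = 1 / ln (exp (- N) / s)"
      and "z = N * log_barrier (exp (- (2 * N))) (exp (- N)) s"
    define u u' where "u = hardy_bump p N s" and "u' = deriv (hardy_bump p N) s"
    have s0: "s > 0" using s(1) by (rule less_trans[rotated]) simp
    note terms = log_barrier_terms[OF exp_gt_zero s]
    have w: "w1 > 0" "w2 > 0" using terms(1,2) by (auto simp: w1_def w2_def)
    have z: "z = N * (w1 + w2)" "z \<ge> 0" using w N by (auto simp: z_def w1_def w2_def log_barrier_def)
    \<comment> \<open>t is the relative perturbation of the derivative, u' = (H u / s)(1 + t); as z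
      = N (w1 + w2), it is of order (1 + z)^2 / N.\<close>
    define t where "t = N * (w1\<^sup>2 - w2\<^sup>2) / H"
    have u: "u = s powr H * exp (- z)"
      using s by (simp add: u_def hardy_bump_def log_bump_def z_def H_def)
    then have u_pos: "u > 0" using s0 by simp
    have "(hardy_bump p N has_real_derivative log_bump N (exp (- (2 * N))) (exp (- N))
      (\<lambda>x. H * x powr (H - 1) + x powr H * (N * (x powr - 1 * ((1 / ln (x / exp (- (2 * N))))\<^sup>2 - (1 / ln (exp (- N) / x))\<^sup>2)))) s) (at s)"
      unfolding hardy_bump_def H_def[symmetric]
    proof (rule log_bump_deriv)
      fix x assume "exp (- (2 * N)) < x"
      then have "x > 0" by (rule less_trans[rotated]) simp
      then show "((\<lambda>x. x powr H) has_real_derivative H * x powr (H - 1)) (at x)"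
        by (auto intro!: derivative_eq_intros)
    qed (use N in \<open>auto intro!: bump_coeff.intros\<close>)
    then have "u' = log_bump N (exp (- (2 * N))) (exp (- N))
      (\<lambda>x. H * x powr (H - 1) + x powr H * (N * (x powr - 1 * ((1 / ln (x / exp (- (2 * N))))\<^sup>2 - (1 / ln (exp (- N) / x))\<^sup>2)))) s"
      unfolding u'_def by (rule DERIV_imp_deriv)
    also have "\<dots> = (H * s powr (H - 1) + s powr H * (N * (s powr - 1 * (w1\<^sup>2 - w2\<^sup>2)))) * exp (- z)"
      unfolding w1_def w2_def using s by (simp only: log_bump_def z_def if_True simp_thms)
    also have "\<dots> = H * u / s * (1 + t)"
      using s0 H by (simp add: u t_def powr_diff powr_minus field_simps)
    finally have u': "u' = H * u / s * (1 + t)" .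
    have "\<bar>u'\<bar> = H * u / s * \<bar>1 + t\<bar>"
      using u_pos s0 H by (simp add: u' abs_mult)
    then have u'p: "\<bar>u'\<bar> powr p = H powr p * u powr p * s powr - p * \<bar>1 + t\<bar> powr p"
      using u_pos s0 H by (simp only:) (simp add: powr_mult powr_divide powr_minus field_simps)
    have cross: "p * u powr (p - 1) * u' * (H powr (p - 1) * s powr (1 - p)) =
        p * H powr p * u powr p * s powr - p * (1 + t)"
      using u_pos s0 H by (simp add: u' powr_diff powr_minus field_simps)
    \<comment> \<open>Because p H = p - 1, the density carries exactly the scale-invariant factor
      1/s.\<close>
    have up: "u powr p * s powr - p = exp (- (p * z)) * (1 / s)"
    proof -
      have "u powr p = s powr (p - 1) * exp (- (p * z))"
        using s0 H(3) by (simp add: u powr_mult powr_powr mult.commute) (simp add: powr_def mult.commute)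
      then show ?thesis using s0 by (simp add: powr_diff powr_minus field_simps)
    qed
    have t: "\<bar>t\<bar> \<le> (1 + z)\<^sup>2 / H / N"
    proof -
      have "\<bar>t\<bar> = N * \<bar>w1\<^sup>2 - w2\<^sup>2\<bar> / H"
        using H N by (simp add: t_def abs_mult)
      also have "\<dots> \<le> N * (w1 + w2)\<^sup>2 / H"
      proof -
        have "\<bar>w1\<^sup>2 - w2\<^sup>2\<bar> \<le> w1\<^sup>2 + w2\<^sup>2"
          using abs_triangle_ineq4[of "w1\<^sup>2" "w2\<^sup>2"] by simp
        also have "\<dots> \<le> (w1 + w2)\<^sup>2" using w by (simp add: power2_sum)
        finally show ?thesis using H N by (intro divide_right_mono mult_left_mono) auto
      qed
      also have "\<dots> = z\<^sup>2 / H / N"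
        using N H by (simp add: z power2_eq_square)
      also have "\<dots> \<le> (1 + z)\<^sup>2 / H / N"
        using z H N by (intro divide_right_mono power_mono) auto
      finally show ?thesis .
    qed
    \<comment> \<open>Since N \<ge> 1, 1 + z \<ge> 1 and 1/H > 1, every power from 2 to k is covered
      by the decay 1/N^2 and the growth of degree 2k.\<close>
    have pw: "\<bar>t\<bar> ^ j \<le> (1 + z) ^ (2 * k) * (1 / H) ^ k / N\<^sup>2" if j: "2 \<le> j" "j \<le> k" for j
    proof -
      have "\<bar>t\<bar> ^ j \<le> ((1 + z)\<^sup>2 / H / N) ^ j"
        using t by (intro power_mono) auto
      also have "\<dots> = (1 + z) ^ (2 * j) * (1 / H) ^ j * (1 / N ^ j)"
        by (simp add: power_divide power_mult power_mult_distrib)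
      also have "\<dots> \<le> (1 + z) ^ (2 * k) * (1 / H) ^ k * (1 / N\<^sup>2)"
        using z H N j by (intro mult_mono power_increasing divide_left_mono) auto
      finally show ?thesis by simp
    qed
    have "\<bar>1 + t\<bar> powr p - 1 - p * t \<le> C * (t\<^sup>2 + \<bar>t\<bar> ^ k)"
      unfolding C_def by (rule abs_one_plus_powr_le[OF p k])
    also have "\<dots> \<le> C * (2 * ((1 + z) ^ (2 * k) * (1 / H) ^ k / N\<^sup>2))"
      using pw[of 2] pw[of k] k C by (intro mult_left_mono) auto
    finally have rem: "\<bar>1 + t\<bar> powr p - 1 - p * t \<le> C * (2 * ((1 + z) ^ (2 * k) * (1 / H) ^ k / N\<^sup>2))" .
    have nonneg: "0 \<le> C * (2 * ((1 + z) ^ (2 * k) * (1 / H) ^ k / N\<^sup>2))"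
      using C z H by simp
    have "H powr p * (exp (- (p * z)) * (1 / s)) * (\<bar>1 + t\<bar> powr p - 1 - p * t) \<le>
        1 * (exp (- (p * z)) * (1 / s)) * (C * (2 * ((1 + z) ^ (2 * k) * (1 / H) ^ k / N\<^sup>2)))"
      using rem s0 H p nonneg
      by (intro order_trans[OF mult_left_mono[OF rem] mult_right_mono] mult_right_mono powr_le1) auto
    also have "\<dots> = C * (2 * (1 / H) ^ k * ((1 + z) ^ (2 * k) * exp (- (p * z)))) / N\<^sup>2 * (1 / s)"
      by (simp add: mult_ac)
    also have "\<dots> \<le> K / N\<^sup>2 * (1 / s)"
      unfolding K_def using B(2)[OF z(2)] C H s0
      by (intro mult_right_mono divide_right_mono mult_left_mono) auto
    finally have main: "H powr p * (exp (- (p * z)) * (1 / s)) * (\<bar>1 + t\<bar> powr p - 1 - p * t) \<le> K / N\<^sup>2 * (1 / s)" .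
    \<comment> \<open>Subtracting the derivative of the Hardy weight times |u|^p leaves just the
      second-order remainder in t.\<close>
    have "\<bar>u'\<bar> powr p - H powr p * s powr - p * u powr p
        - (- (p * H powr p * s powr - p) * u powr p + p * u powr (p - 1) * u' * (H powr (p - 1) * s powr (1 - p)))
        = H powr p * (u powr p * s powr - p) * (\<bar>1 + t\<bar> powr p - 1 - p * t)"
      unfolding u'p cross by (simp add: algebra_simps)
    also have "\<dots> \<le> K / N\<^sup>2 * (1 / s)" using main up by simp
    finally show "hardy_density p (hardy_bump p N) (deriv (hardy_bump p N)) s \<le>
      - (p * ((p - 1) / p) powr p * s powr - p) * \<bar>hardy_bump p N s\<bar> powr p +
      (p * \<bar>hardy_bump p N s\<bar> powr (p - 1) * sgn (hardy_bump p N s) * deriv (hardy_bump p N) s) *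
        (((p - 1) / p) powr (p - 1) * s powr (1 - p)) + K / N\<^sup>2 * (1 / s)"
      using u_pos unfolding u_def[symmetric] u'_def[symmetric] H_def[symmetric] hardy_density_def
      by simp
  qed
qed

lemma hardy_bump_test_function:
  assumes "N > 0" "exp (- N) < R"
  shows "hardy_bump p N \<in> test_functions R"
  unfolding hardy_bump_def using assms
  by (intro log_bump_test_function bump_coeff.intros) auto

lemma hardy_bump_outside:
  assumes "N > 0" "s \<le> exp (- (2 * N)) \<or> exp (- N) \<le> s"
  shows "hardy_bump p N s = 0" "deriv (hardy_bump p N) s = 0"
proof -
  show "hardy_bump p N s = 0"
    using assms by (auto simp: hardy_bump_def log_bump_def)
  obtain h' where h': "bump_coeff (exp (- (2 * N))) (exp (- N)) h'"
    "\<And>x. exp (- (2 * N)) < x \<Longrightarrow> x < exp (- N) \<Longrightarrow> ((\<lambda>x. x powr ((p - 1) / p)) has_real_derivative h' x) (at x)"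
    using bump_coeff_deriv[OF bump_coeff.powr exp_gt_zero] by blast
  have "deriv (hardy_bump p N) s = log_bump N (exp (- (2 * N))) (exp (- N)) (\<lambda>x. h' x + x powr ((p - 1) / p) *
      (N * (x powr - 1 * ((1 / ln (x / exp (- (2 * N))))\<^sup>2 - (1 / ln (exp (- N) / x))\<^sup>2)))) s"
    unfolding hardy_bump_def
    by (rule DERIV_imp_deriv[OF log_bump_deriv[OF bump_coeff.powr exp_gt_zero assms(1) h']])
  then show "deriv (hardy_bump p N) s = 0"
    using assms by (auto simp: log_bump_def)
qed

text \<open>The exact derivative integrates to zero because the bump vanishes at both ends. The
  error is K/N^2 times the integral of 1/s from exp(-2N) to exp(-N), which is N. The support lies in
  the left half, so K does not depend on R.\<close>

lemma hardy_bump_deficit: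
  fixes p :: real
  assumes p: "p > 1"
  obtains K where "K \<ge> 0"
    "\<And>N R. N \<ge> 1 \<Longrightarrow> exp (- N) < R / 2 \<Longrightarrow> hardy_deficit p R (hardy_bump p N) \<le> K / N"
proof -
  obtain K where K: "K \<ge> 0" and dens: "\<And>N s. N \<ge> 1 \<Longrightarrow> exp (- (2 * N)) < s \<Longrightarrow> s < exp (- N) \<Longrightarrow>
      hardy_density p (hardy_bump p N) (deriv (hardy_bump p N)) s \<le>
      - (p * ((p - 1) / p) powr p * s powr - p) * \<bar>hardy_bump p N s\<bar> powr p +
      (p * \<bar>hardy_bump p N s\<bar> powr (p - 1) * sgn (hardy_bump p N s) * deriv (hardy_bump p N) s) *
        (((p - 1) / p) powr (p - 1) * s powr (1 - p)) + K / N\<^sup>2 * (1 / s)"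
    using hardy_bump_density[OF p] by blast
  show ?thesis
  proof (rule that[OF K])
    fix N R :: real assume N: "N \<ge> 1" and R: "exp (- N) < R / 2"
    define \<alpha> \<beta> u where "\<alpha> = exp (- (2 * N))" and "\<beta> = exp (- N)" and "u = hardy_bump p N"
    have R0: "R > 0" using R exp_gt_zero[of "- N"] by linarith
    have \<alpha>: "0 < \<alpha>" "\<alpha> < \<beta>" "\<beta> < R / 2" using N R by (auto simp: \<alpha>_def \<beta>_def)
    have u: "u \<in> test_functions R"
      unfolding u_def using N R R0 by (intro hardy_bump_test_function) auto
    have out: "u s = 0" "deriv u s = 0" if "s \<le> \<alpha> \<or> \<beta> \<le> s" for s
      using hardy_bump_outside[of N s p] N that by (auto simp: u_def \<alpha>_def \<beta>_def)
    have "hardy_deficit p R u = integral {\<alpha> / 2..R / 2} (hardy_density p u (deriv u))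
        + integral {\<alpha> / 2..R / 2} (hardy_density p (\<lambda>x. u (R - x)) (\<lambda>x. - deriv u (R - x)))"
      by (rule hardy_deficit_split[OF p R0 u, of "\<alpha> / 2" \<alpha>]) (use \<alpha> out in auto)
    also have "integral {\<alpha> / 2..R / 2} (hardy_density p (\<lambda>x. u (R - x)) (\<lambda>x. - deriv u (R - x)))
        = integral {\<alpha> / 2..R / 2} (\<lambda>_. 0)"
      by (rule integral_cong) (use \<alpha> out p in \<open>auto simp: hardy_density_def\<close>)
    also have "integral {\<alpha> / 2..R / 2} (hardy_density p u (deriv u)) = integral {\<alpha>..\<beta>} (hardy_density p u (deriv u))"
    proof (rule integral_unique, rule has_integral_on_superset)
      show "(hardy_density p u (deriv u) has_integral integral {\<alpha>..\<beta>} (hardy_density p u (deriv u))) {\<alpha>..\<beta>}"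
        using p \<alpha> test_functionsD[OF u] by (intro integrable_integral hardy_density_integrable)
    qed (use \<alpha> out p in \<open>auto simp: hardy_density_def\<close>)
    also have "integral {\<alpha>..\<beta>} (hardy_density p u (deriv u)) \<le> K / N"
    proof -
      have F: "((\<lambda>s. - (p * ((p - 1) / p) powr p * s powr - p) * \<bar>u s\<bar> powr p +
          (p * \<bar>u s\<bar> powr (p - 1) * sgn (u s) * deriv u s) * (((p - 1) / p) powr (p - 1) * s powr (1 - p))
          + K / N\<^sup>2 * (1 / s)) has_integral
          (((p - 1) / p) powr (p - 1) * \<beta> powr (1 - p) * \<bar>u \<beta>\<bar> powr p + K / N\<^sup>2 * ln \<beta>)
          - (((p - 1) / p) powr (p - 1) * \<alpha> powr (1 - p) * \<bar>u \<alpha>\<bar> powr p + K / N\<^sup>2 * ln \<alpha>)) {\<alpha>..\<beta>}"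
      proof (rule fundamental_theorem_of_calculus)
        fix s assume s: "s \<in> {\<alpha>..\<beta>}"
        then have s0: "s > 0" using \<alpha> by auto
        have "((\<lambda>s. ((p - 1) / p) powr (p - 1) * s powr (1 - p) * \<bar>u s\<bar> powr p + K / N\<^sup>2 * ln s)
          has_real_derivative - (p * ((p - 1) / p) powr p * s powr - p) * \<bar>u s\<bar> powr p +
          (p * \<bar>u s\<bar> powr (p - 1) * sgn (u s) * deriv u s) * (((p - 1) / p) powr (p - 1) * s powr (1 - p))
          + K / N\<^sup>2 * (1 / s)) (at s)"
          by (intro DERIV_add DERIV_mult DERIV_cmult hardy_weight(1)[OF p s0] DERIV_ln_divide[OF s0]
              DERIV_chain2[OF has_real_derivative_abs_powr[OF p] test_functionsD(1)[OF u]])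
        then show "((\<lambda>s. ((p - 1) / p) powr (p - 1) * s powr (1 - p) * \<bar>u s\<bar> powr p + K / N\<^sup>2 * ln s)
          has_vector_derivative - (p * ((p - 1) / p) powr p * s powr - p) * \<bar>u s\<bar> powr p +
          (p * \<bar>u s\<bar> powr (p - 1) * sgn (u s) * deriv u s) * (((p - 1) / p) powr (p - 1) * s powr (1 - p))
          + K / N\<^sup>2 * (1 / s)) (at s within {\<alpha>..\<beta>})"
          by (simp add: has_real_derivative_iff_has_vector_derivative has_vector_derivative_at_within)
      qed (use \<alpha> in auto)
      have "(hardy_density p u (deriv u) has_integral integral {\<alpha>..\<beta>} (hardy_density p u (deriv u))) {\<alpha>..\<beta>}"
        using p \<alpha> test_functionsD[OF u] by (intro integrable_integral hardy_density_integrable)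
      from this F have "integral {\<alpha>..\<beta>} (hardy_density p u (deriv u)) \<le>
          (((p - 1) / p) powr (p - 1) * \<beta> powr (1 - p) * \<bar>u \<beta>\<bar> powr p + K / N\<^sup>2 * ln \<beta>)
          - (((p - 1) / p) powr (p - 1) * \<alpha> powr (1 - p) * \<bar>u \<alpha>\<bar> powr p + K / N\<^sup>2 * ln \<alpha>)"
      proof (rule has_integral_le)
        fix s assume s: "s \<in> {\<alpha>..\<beta>}"
        then have s0: "s > 0" using \<alpha> by auto
        show "hardy_density p u (deriv u) s \<le> - (p * ((p - 1) / p) powr p * s powr - p) * \<bar>u s\<bar> powr p +
          (p * \<bar>u s\<bar> powr (p - 1) * sgn (u s) * deriv u s) * (((p - 1) / p) powr (p - 1) * s powr (1 - p))
          + K / N\<^sup>2 * (1 / s)"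
        proof (cases "\<alpha> < s \<and> s < \<beta>")
          case True
          then show ?thesis unfolding u_def \<alpha>_def \<beta>_def using N by (intro dens) auto
        next
          case False
          then have "u s = 0" "deriv u s = 0" using out[of s] by auto
          then show ?thesis using K s0 by (simp add: hardy_density_def)
        qed
      qed
      also have "\<dots> = K / N"
        using out[of \<alpha>] out[of \<beta>] N by (simp add: \<alpha>_def \<beta>_def power2_eq_square field_simps)
      finally show ?thesis .
    qed
    finally show "hardy_deficit p R (hardy_bump p N) \<le> K / N" by (simp add: u_def)
  qed
qed

text \<open>The inequality for all bumps would force N^(-r) to be at most a constant times N^(-1/p)
  for all large N, with r = max(q, 0) < 1/p. This rules out every fixed R separately.\<close>

lemma hardy_morrey_weight_optimal:
  fixes p q R b c :: real
  assumes p: "p > 1" and q: "q < 1 / p" and R: "R > 0" and b: "b \<ge> 1" and c: "c > 0"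
  shows "\<exists>u\<in>test_functions R. \<not> hardy_morrey_ineq p q b c R u"
proof (rule ccontr)
  assume "\<not> ?thesis"
  then have ineq: "hardy_morrey_ineq p q b c R u" if "u \<in> test_functions R" for u
    using that by blast
  obtain K where K: "K \<ge> 0"
    "\<And>N R. N \<ge> 1 \<Longrightarrow> exp (- N) < R / 2 \<Longrightarrow> hardy_deficit p R (hardy_bump p N) \<le> K / N"
    using hardy_bump_deficit[OF p] by blast
  \<comment> \<open>Passing to a nonnegative exponent is harmless: X \<le> 1 gives X^r \<le>
    X^q.\<close>
  define r where "r = max q 0"
  have r: "q \<le> r" "0 \<le> r" "r < 1 / p" using q p by (auto simp: r_def)
  define M where "M = 1 + ln (2 * (b * R))"
  have bR: "b * R \<ge> R" "b * R > 0" using b R by (auto simp: mult_le_cancel_right1)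
  have key: "exp (- 4) * (3 * N) powr - r \<le> c * (K / N) powr (1 / p)"
    if N: "N \<ge> 2" "\<bar>M\<bar> \<le> N" "exp (- N) < R / 2" for N
  proof -
    \<comment> \<open>The quotient is tested between the left end of the support, where u = 0, and
      its logarithmic midpoint x. There both barrier terms are 2/N, so the cutoff equals exp(-4) for
      every N.\<close>
    define \<alpha> x h u where "\<alpha> = exp (- (2 * N))" and "x = exp (- (3 * N / 2))" and "h = x - \<alpha>"
      and "u = hardy_bump p N"
    have ord: "0 < \<alpha>" "\<alpha> < x" "x < exp (- N)"
      using N by (auto simp: \<alpha>_def x_def)
    have R2: "\<alpha> < R" "x < R" using ord N R by auto
    have u: "u \<in> test_functions R"
      unfolding u_def using N R by (intro hardy_bump_test_function) auto
    have "\<alpha> = x * exp (- (N / 2))" by (simp add: \<alpha>_def x_def flip: exp_add)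
    also have "exp (- (N / 2)) \<le> 1 / 2"
    proof -
      have "2 \<le> 1 + N / 2" using N by simp
      also have "\<dots> \<le> exp (N / 2)" by (rule exp_ge_add_one_self)
      finally show ?thesis by (simp add: exp_minus field_simps)
    qed
    finally have "\<alpha> \<le> x / 2" using ord by simp
    then have h: "x / 2 \<le> h" "h \<le> x" "0 < h" using ord by (auto simp: h_def)
    have ux: "u x = x powr ((p - 1) / p) * exp (- 4)"
    proof -
      have "x / \<alpha> = exp (N / 2)" "exp (- N) / x = exp (N / 2)"
        by (simp_all add: x_def \<alpha>_def flip: exp_diff)
      then show ?thesis
        using ord N by (simp add: u_def hardy_bump_def log_bump_def log_barrier_def \<alpha>_def)
    qed
    have u\<alpha>: "u \<alpha> = 0" unfolding u_def using N by (intro hardy_bump_outside) (auto simp: \<alpha>_def)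
    have "h / (b * R) \<le> 1" using h R2 bR by (subst pos_divide_le_eq) linarith+
    then have ln_le: "ln (h / (b * R)) \<le> 0" using h bR by simp
    have X: "0 < X (h / (b * R))" "X (h / (b * R)) \<le> 1"
      using ln_le by (auto simp: X_def field_simps)
    \<comment> \<open>As h \<ge> x/2, the denominator of X is at most M + 3N/2, where M collects the
      terms free of N; |M| \<le> N then gives 3N.\<close>
    have "ln (x / 2) \<le> ln h" using h ord by (intro ln_mono) auto
    then have "1 - ln (h / (b * R)) \<le> M + 3 * N / 2"
      using h bR ord by (simp add: M_def ln_div ln_mult x_def)
    also have "\<dots> \<le> 3 * N" using N by linarith
    finally have "1 - ln (h / (b * R)) \<le> 3 * N" .
    then have "inverse (3 * N) \<le> X (h / (b * R))"
      unfolding X_def using ln_le by (intro le_imp_inverse_le) auto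
    then have "(inverse (3 * N)) powr r \<le> X (h / (b * R)) powr r"
      using N r by (intro powr_mono2) auto
    also have "\<dots> \<le> X (h / (b * R)) powr q"
      using X r by (intro powr_mono') auto
    finally have Xq: "(3 * N) powr - r \<le> X (h / (b * R)) powr q"
      using N inverse_powr[of "3 * N" r] by (simp only: powr_minus)
    have "h powr (1 - 1 / p) \<le> x powr ((p - 1) / p)"
      using p h by (auto simp: diff_divide_distrib intro!: powr_mono2)
    then have "exp (- 4) \<le> \<bar>u x - u \<alpha>\<bar> / h powr (1 - 1 / p)"
      using h ord by (simp add: ux u\<alpha> pos_le_divide_eq)
    then have "exp (- 4) * (3 * N) powr - r \<le> \<bar>u x - u \<alpha>\<bar> / h powr (1 - 1 / p) * X (h / (b * R)) powr q"
      using Xq by (intro mult_mono) auto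
    also have "h = \<bar>x - \<alpha>\<bar>" using ord by (simp add: h_def)
    also have "\<bar>u x - u \<alpha>\<bar> / \<bar>x - \<alpha>\<bar> powr (1 - 1 / p) * X (\<bar>x - \<alpha>\<bar> / (b * R)) powr q
        \<le> c * hardy_deficit p R u powr (1 / p)" (is "?Q \<le> _")
    proof -
      have "ereal ?Q \<le> weighted_hoelder_seminorm p q (b * R) R u"
        unfolding weighted_hoelder_seminorm_def
        by (rule SUP_upper2[of "(x, \<alpha>)"]) (use ord R2 in auto)
      also have "\<dots> \<le> ereal (c * hardy_deficit p R u powr (1 / p))"
        using ineq[OF u] by (simp only: hardy_morrey_ineq_def)
      finally show ?thesis by (simp only: ereal_less_eq)
    qed
    also have "\<dots> \<le> c * (K / N) powr (1 / p)"
    proof (intro mult_left_mono powr_mono2)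
      show "hardy_deficit p R u \<le> K / N"
        unfolding u_def using N by (intro K(2)) auto
      show "0 \<le> hardy_deficit p R u"
        by (rule test_function_hoelder(2)[OF p R u ord(1,2) R2(2)])
    qed (use p c in auto)
    finally show ?thesis by simp
  qed
  define \<delta> where "\<delta> = 1 / p - r"
  have \<delta>: "\<delta> > 0" using r by (simp add: \<delta>_def)
  \<comment> \<open>B gathers all constants after clearing powers of N, so that \<open>key\<close>
    becomes N^\<delta> \<le> B; this fails for large N since \<delta> > 0.\<close>
  define B where "B = c * K powr (1 / p) * 3 powr r * exp 4"
  have "\<forall>\<^sub>F N in at_top. (\<bar>B\<bar> + 1) powr (1 / \<delta>) \<le> N"
    by (rule eventually_ge_at_top)
  then have "\<forall>\<^sub>F N in at_top. B < N powr \<delta>"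
  proof eventually_elim
    case (elim N)
    then have "((\<bar>B\<bar> + 1) powr (1 / \<delta>)) powr \<delta> \<le> N powr \<delta>"
      using \<delta> by (intro powr_mono2) auto
    then show ?case using \<delta> by (simp add: powr_powr)
  qed
  moreover have "((\<lambda>N::real. exp (- N)) \<longlongrightarrow> 0) at_top"
    by (intro filterlim_compose[OF exp_at_bot] filterlim_uminus_at_bot_at_top)
  then have "\<forall>\<^sub>F N::real in at_top. exp (- N) < R / 2"
    using R by (intro order_tendstoD) auto
  moreover have "\<forall>\<^sub>F N in at_top. N \<ge> max 2 \<bar>M\<bar>"
    by (rule eventually_ge_at_top)
  ultimately have "\<forall>\<^sub>F N::real in at_top. False"
  proof eventually_elim
    case (elim N)
    then have N: "N \<ge> 2" by simp
    have "exp (- 4) * (3 * N) powr - r \<le> c * (K / N) powr (1 / p)"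
      using elim by (intro key) auto
    then have "exp 4 * (3 * N) powr r * N powr (1 / p) * (exp (- 4) * (3 * N) powr - r)
        \<le> exp 4 * (3 * N) powr r * N powr (1 / p) * (c * (K / N) powr (1 / p))"
      by (intro mult_left_mono) auto
    then have "N powr (1 / p) \<le> B * N powr r"
      using N K by (simp add: B_def exp_minus powr_minus powr_divide powr_mult field_simps)
    then have "N powr \<delta> \<le> B"
      using N by (simp add: \<delta>_def powr_diff field_simps)
    with elim show False by simp
  qed
  then show False by simp
qed

theorem theoremX:
  fixes p :: real
  assumes "p > 1"
  shows "(\<exists>b\<ge>1. \<exists>c>0. \<forall>R>0. \<forall>u\<in>test_functions R. hardy_morrey_ineq p (1 / p) b c R u) \<and>
    (\<forall>q<1 / p. \<forall>R>0. \<not> (\<exists>b\<ge>1. \<exists>c>0. \<forall>u\<in>test_functions R. hardy_morrey_ineq p q b c R u))"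
  using hardy_morrey_log_weight[OF assms] hardy_morrey_weight_optimal[OF assms] by blast

end
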